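(* Consider the quadratic program $\min_{x,s}\; q(x):=\tfrac12x^\top Qx+p^\top x$ subject to $Ax+s=b$, $s\ge0$, with $Q\in\mathbb R^{n\times n}$ symmetric positive semidefinite, $p\in\mathbb R^n$, $A\in\mathbb R^{m\times n}$, $b\in\mathbb R^m$. Let $$r(x,s,t):=\tfrac12\max\{q(x)-t,0\}^2+\tfrac12\big(|Ax+s-b|^2+|(-s)_+|^2\big),\quad r^\star(t):=\min_{x,s}r(x,s,t),\quad t^\star:=\min\{t\in\mathbb R:0\in\partial r^\star(t)\}.$$ Then the following statements are true: (1) For any $t\in\mathbb R$, the function $(x,s)\mapsto r(x,s,t)$ attains its minimum. (2) The operator $\partial r^\star$ satisfies the calmness criterion: the set $S:=(\partial r^\star)^{-1}(0)$ is nonempty and there exist $\vartheta>0$, $\varphi>0$ such that for every $t\in\mathbb R$, if $w\in\partial r^\star(t)$ and $|w|<\vartheta$, then $|t-\Pi_S(t)|\le\varphi|w|$. (3) The Proximal Value Method (defined in the context) initialised with $t_0\le t^\star$ produces a sequence $\{t_k\}$ that converges to a neighbourhood of $t^\star$ at a superlinear rate if $\sigma_k\uparrow\infty$, or at a linear rate if $\sigma_k$ is constant.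
   Context: $|\cdot|$ is the Euclidean norm, $(v)_+$ is the componentwise $\max\{\cdot,0\}$, $\Pi_S$ is the projection onto $S$, $\partial$ is the convex subdifferential, and $\operatorname{prox}_{\sigma h}(y):=\arg\min_x h(x)+\frac1{2\sigma}|x-y|^2$. Proximal Value Method (PVM): given $t_0$ and $\sigma_k>0$, at each iteration $k$ the method inexactly computes $(x_{k+1/2},s_{k+1/2})\in\arg\min_{x,s}r(x,s,t_k)$ and then inexactly computes $(x_{k+1},s_{k+1},t_{k+1})=\operatorname{prox}_{\sigma_k r}(x_{k+1/2},s_{k+1/2},t_k)$, the two inexact solves being accurate enough that $$|t_{k+1}-\operatorname{prox}_{\sigma_k r^\star}(t_k)|\le\varepsilon_k\min\{1,|t_{k+1}-t_k|^\varsigma\},\qquad \sum_{k=0}^\infty\varepsilon_k<\infty,$$ with $\varepsilon_k\ge 0$ and $\varsigma\ge1$. "Converges to a neighbourhood of $t^\star$" means that $\{t_k\}$ converges to some limit $\tau\in[t^\star,t^\star+\lambda]$ with $\lambda:=\sum_{k=0}^\infty\varepsilon_k\min\{1,|t_{k+1}-t_k|^\varsigma\}$. *)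

theory Defs
  imports "HOL-Analysis.Analysis"
begin

definition subdifferential :: "('a::real_inner \<Rightarrow> real) \<Rightarrow> 'a \<Rightarrow> 'a set" where
  "subdifferential f x = {w. \<forall>y. f y \<ge> f x + w \<bullet> (y - x)}"

(* The minimiser is unique when h is convex and lower semicontinuous; in general this is some
   minimiser, if one exists. *)
definition prox :: "real \<Rightarrow> ('a::real_normed_vector \<Rightarrow> real) \<Rightarrow> 'a \<Rightarrow> 'a" where
  "prox \<sigma> h y = arg_min (\<lambda>x. h x + 1 / (2 * \<sigma>) * (norm (x - y))\<^sup>2) (\<lambda>_. True)"

(* closest_point S is the projection onto S for nonempty closed convex S. *)
definition calmness_criterion :: "('a::euclidean_space \<Rightarrow> 'a set) \<Rightarrow> bool" where
  "calmness_criterion T \<longleftrightarrow>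
     (let S = {t. 0 \<in> T t} in
        S \<noteq> {} \<and>
        (\<exists>\<theta>>0. \<exists>\<phi>>0. \<forall>t. \<forall>w\<in>T t.
            norm w < \<theta> \<longrightarrow> norm (t - closest_point S t) \<le> \<phi> * norm w))"

definition is_minimum :: "'a::linorder set \<Rightarrow> 'a \<Rightarrow> bool" where
  "is_minimum X a \<longleftrightarrow> a \<in> X \<and> (\<forall>x\<in>X. a \<le> x)"

definition pos_part :: "real^'m \<Rightarrow> real^'m" where
  "pos_part v = (\<chi> i. max (v $ i) 0)"

definition quad_obj :: "real^'n^'n \<Rightarrow> real^'n \<Rightarrow> real^'n \<Rightarrow> real" where
  "quad_obj Q p x = 1 / 2 * (x \<bullet> (Q *v x)) + p \<bullet> x"

definition residual ::
  "real^'n^'n \<Rightarrow> real^'n \<Rightarrow> real^'n^'m \<Rightarrow> real^'m \<Rightarrow> real^'n \<Rightarrow> real^'m \<Rightarrow> real \<Rightarrow> real" where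
  "residual Q p A b x s t =
     1 / 2 * (max (quad_obj Q p x - t) 0)\<^sup>2
     + 1 / 2 * ((norm (A *v x + s - b))\<^sup>2 + (norm (pos_part (- s)))\<^sup>2)"

(* The infimum is over a set bounded below by 0. *)
definition residual_value ::
  "real^'n^'n \<Rightarrow> real^'n \<Rightarrow> real^'n^'m \<Rightarrow> real^'m \<Rightarrow> real \<Rightarrow> real" where
  "residual_value Q p A b t = (INF (x, s). residual Q p A b x s t)"

definition error_bound :: "(nat \<Rightarrow> real) \<Rightarrow> real \<Rightarrow> (nat \<Rightarrow> real) \<Rightarrow> nat \<Rightarrow> real" where
  "error_bound \<epsilon> \<nu> t k = \<epsilon> k * min 1 (\<bar>t (Suc k) - t k\<bar> powr \<nu>)"

(* (xh k, sh k) are the half-step iterates and (x k, s k, t k) the full iterates; x 0 and s 0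
   play no role.  \<alpha> and \<beta> are the errors of the two inexact solves: no decay is prescribed for
   them, they only have to be compatible with the accuracy criterion on t in the last conjunct. *)
definition proximal_value_method ::
  "real^'n^'n \<Rightarrow> real^'n \<Rightarrow> real^'n^'m \<Rightarrow> real^'m \<Rightarrow>
   (nat \<Rightarrow> real) \<Rightarrow> (nat \<Rightarrow> real) \<Rightarrow> real \<Rightarrow> (nat \<Rightarrow> real) \<Rightarrow> (nat \<Rightarrow> real) \<Rightarrow>
   (nat \<Rightarrow> real^'n) \<Rightarrow> (nat \<Rightarrow> real^'m) \<Rightarrow>
   (nat \<Rightarrow> real^'n) \<Rightarrow> (nat \<Rightarrow> real^'m) \<Rightarrow> (nat \<Rightarrow> real) \<Rightarrow> bool" where
  "proximal_value_method Q p A b \<sigma> \<epsilon> \<nu> \<alpha> \<beta> xh sh x s t \<longleftrightarrow>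
     (\<forall>k. \<sigma> k > 0) \<and> (\<forall>k. \<epsilon> k \<ge> 0) \<and> summable \<epsilon> \<and> \<nu> \<ge> 1 \<and>
     (\<forall>k. residual Q p A b (xh k) (sh k) (t k) \<le> residual_value Q p A b (t k) + \<alpha> k) \<and>
     (\<forall>k. norm ((x (Suc k), s (Suc k), t (Suc k))
                 - prox (\<sigma> k) (\<lambda>(x, s, t). residual Q p A b x s t) (xh k, sh k, t k)) \<le> \<beta> k) \<and>
     (\<forall>k. \<bar>t (Suc k) - prox (\<sigma> k) (residual_value Q p A b) (t k)\<bar> \<le> error_bound \<epsilon> \<nu> t k)"

(* Q-linear and Q-superlinear convergence, stated without dividing by |t k - \<tau>|, so that
   sequences that reach their limit in finitely many steps are included. *)
definition converges_linearly :: "(nat \<Rightarrow> real) \<Rightarrow> real \<Rightarrow> bool" where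
  "converges_linearly t \<tau> \<longleftrightarrow>
     t \<longlonglongrightarrow> \<tau> \<and>
     (\<exists>c. 0 \<le> c \<and> c < 1 \<and> (\<forall>\<^sub>F k in sequentially. \<bar>t (Suc k) - \<tau>\<bar> \<le> c * \<bar>t k - \<tau>\<bar>))"

definition converges_superlinearly :: "(nat \<Rightarrow> real) \<Rightarrow> real \<Rightarrow> bool" where
  "converges_superlinearly t \<tau> \<longleftrightarrow>
     t \<longlonglongrightarrow> \<tau> \<and>
     (\<exists>c. c \<longlonglongrightarrow> 0 \<and> (\<forall>\<^sub>F k in sequentially. \<bar>t (Suc k) - \<tau>\<bar> \<le> c k * \<bar>t k - \<tau>\<bar>))"

end

theory Submission
  imports Defs
begin

text \<open>Minimising out the slack \<open>s\<close> leaves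
  \<open>r(x, t) = 1/2 max{q(x) - t, 0}\<^sup>2 + 1/4 |(A x - b)\<^sub>+|\<^sup>2\<close>, whose value function is convex and
  nonincreasing in \<open>t\<close>. A Lagrange multiplier of the program (with \<open>b\<close> relaxed by the least violation,
  so that feasibility is not needed) gives global quadratic growth
  \<open>r\<^sup>\<star>(t) \<ge> r\<^sup>\<star>(t\<^sup>\<star>) + c (t\<^sup>\<star> - t)\<^sup>2\<close> for \<open>t \<le> t\<^sup>\<star>\<close>. This yields calmness, and it makes an exact
  proximal step contract the distance to \<open>t\<^sup>\<star>\<close> by \<open>1 / (1 + c \<sigma>)\<close> from the left of \<open>t\<^sup>\<star>\<close>, while
  points right of \<open>t\<^sup>\<star>\<close> are fixed. The inexact iterates therefore either converge to \<open>t\<^sup>\<star>\<close> from the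
  left at the contraction rate, or pass \<open>t\<^sup>\<star>\<close> once \<open>\<epsilon>\<^sub>k < 1\<close>; since the error is then at most
  \<open>\<epsilon>\<^sub>k |t\<^sub>k\<^sub>+\<^sub>1 - t\<^sub>k|\<close>, they stop there.\<close>

section \<open>The inexact proximal point iteration on the real line\<close>

text \<open>Divide by \<open>r > 0\<close> and let \<open>r\<close> tend to 0. The first-order
  optimality arguments below all end in this limit.\<close>

lemma linear_coeff_nonneg:
  fixes a c :: real
  assumes "\<forall>\<^sub>F r in at_right 0. 0 \<le> a * r + c * r\<^sup>2"
  shows "0 \<le> a"
proof -
  have "\<forall>\<^sub>F r::real in at_right 0. 0 < r"
    by (rule eventually_at_right_less)
  with assms have "\<forall>\<^sub>F r in at_right 0. 0 \<le> a + c * r"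
  proof eventually_elim
    case (elim r)
    then have "0 \<le> r * (a + c * r)"
      by (simp add: algebra_simps power2_eq_square)
    with elim show ?case
      by (simp add: zero_le_mult_iff)
  qed
  moreover have "((\<lambda>r. a + c * r) \<longlongrightarrow> a + c * 0) (at_right 0)"
    by (intro tendsto_intros)
  ultimately show ?thesis
    using tendsto_lowerbound by fastforce
qed

text \<open>\<open>prox\<close> is a mere choice by \<open>arg_min\<close>, so existence of a
  minimiser has to come first. \<open>R\<close> is the distance from \<open>y\<close> at which the
  quadratic term alone makes up for \<open>f y - m\<close>; a minimum over the compact ball of
  radius \<open>R\<close> is therefore global.\<close>

lemma prox_minimises:
  fixes f :: "real \<Rightarrow> real"
  assumes conv: "convex_on UNIV f" and bound: "\<And>t. m \<le> f t" and "\<sigma> > 0"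
  shows "f (prox \<sigma> f y) + 1 / (2 * \<sigma>) * (prox \<sigma> f y - y)\<^sup>2 \<le> f z + 1 / (2 * \<sigma>) * (z - y)\<^sup>2"
proof -
  define G where "G z = f z + 1 / (2 * \<sigma>) * (norm (z - y))\<^sup>2" for z
  define R where "R = sqrt (2 * \<sigma> * (f y - m))"
  have R0: "R \<ge> 0"
    using bound \<open>\<sigma> > 0\<close> by (simp add: R_def)
  have "continuous_on UNIV f"
    using conv convex_on_continuous by blast
  then have "continuous_on (cball y R) G"
    unfolding G_def by (intro continuous_intros) (auto elim: continuous_on_subset)
  moreover have "cball y R \<noteq> {}"
    using R0 by simp
  ultimately obtain u where u: "u \<in> cball y R" "\<And>z. z \<in> cball y R \<Longrightarrow> G u \<le> G z"
    using continuous_attains_inf[OF compact_cball] by blast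
  have "G u \<le> G z" for z
  proof (cases "z \<in> cball y R")
    case False
    then have "R\<^sup>2 \<le> (norm (z - y))\<^sup>2"
      using R0 by (intro power_mono) (auto simp: dist_norm norm_minus_commute)
    moreover have "R\<^sup>2 = 2 * \<sigma> * (f y - m)"
      using bound \<open>\<sigma> > 0\<close> by (simp add: R_def)
    ultimately have "f y - m \<le> 1 / (2 * \<sigma>) * (norm (z - y))\<^sup>2"
      using \<open>\<sigma> > 0\<close> by (simp add: field_simps)
    then have "G y \<le> G z"
      using bound[of z] by (simp add: G_def)
    moreover have "G u \<le> G y"
      using u(2) R0 by simp
    ultimately show ?thesis by simp
  qed (use u in auto)
  then have "is_arg_min G (\<lambda>_. True) u"
    by (simp add: is_arg_min_linorder)
  then have "is_arg_min G (\<lambda>_. True) (arg_min G (\<lambda>_. True))"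
    unfolding arg_min_def by (rule someI)
  moreover have "arg_min G (\<lambda>_. True) = prox \<sigma> f y"
    by (simp add: prox_def G_def[abs_def])
  ultimately show ?thesis
    by (simp add: is_arg_min_linorder G_def)
qed

section \<open>Exact proximal steps on either side of the minimiser\<close>

context
  fixes f :: "real \<Rightarrow> real" and ts c :: real
  assumes conv: "convex_on UNIV f" and anti: "antimono f"
    and minimal: "\<And>t. f ts \<le> f t"
    and growth: "\<And>t. t \<le> ts \<Longrightarrow> f ts + c * (ts - t)\<^sup>2 \<le> f t"
begin

text \<open>Right of \<open>ts\<close> the function already has its least value, so any move only
  adds to the quadratic term.\<close>

lemma prox_above_minimiser:
  assumes "\<sigma> > 0" "ts \<le> t"
  shows "prox \<sigma> f t = t"
proof -
  have "f t \<le> f (prox \<sigma> f t)"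
    using order_trans[OF antimonoD[OF anti assms(2)] minimal] .
  then have "1 / (2 * \<sigma>) * (prox \<sigma> f t - t)\<^sup>2 \<le> 0"
    using prox_minimises[OF conv minimal assms(1), of t t] by simp
  then show ?thesis
    using assms(1) by (simp add: divide_le_0_iff)
qed

text \<open>Moving from the proximal point \<open>u\<close> towards \<open>ts\<close> cannot lower
  the proximal objective. With convexity this bounds \<open>f u - f ts\<close> by
  \<open>(ts - u) * (u - t) / \<sigma>\<close>, and growth bounds it below by
  \<open>c * (ts - u)\<^sup>2\<close>; cancelling \<open>ts - u\<close> gives the
  contraction.\<close>

lemma prox_below_minimiser:
  assumes "\<sigma> > 0" "t \<le> ts" "c > 0"
  shows "prox \<sigma> f t \<le> ts" "(1 + c * \<sigma>) * (ts - prox \<sigma> f t) \<le> ts - t"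
proof -
  define u where "u = prox \<sigma> f t"
  have le: "f u + 1 / (2 * \<sigma>) * (u - t)\<^sup>2 \<le> f z + 1 / (2 * \<sigma>) * (z - t)\<^sup>2" for z
    unfolding u_def by (rule prox_minimises[OF conv minimal assms(1)])
  \<comment> \<open>Compared with \<open>ts\<close>, where \<open>f\<close> is least, the point
    \<open>u\<close> can be no farther from \<open>t\<close>; so it does not pass
    \<open>ts\<close>.\<close>
  have "1 / (2 * \<sigma>) * (u - t)\<^sup>2 \<le> 1 / (2 * \<sigma>) * (ts - t)\<^sup>2"
    using le[of ts] minimal[of u] by linarith
  then have "(u - t)\<^sup>2 \<le> (ts - t)\<^sup>2"
    using assms(1) by (simp add: divide_le_cancel)
  then show u: "prox \<sigma> f t \<le> ts"
    using assms(2) power2_le_imp_le unfolding u_def[symmetric] by fastforce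
  have "0 \<le> 1 / \<sigma> * (ts - u) * (u - t) - (f u - f ts)"
  proof (rule linear_coeff_nonneg)
    have "\<forall>\<^sub>F r::real in at_right 0. 0 < r \<and> r < 1"
      using eventually_at_right_real[of 0 1] by (auto simp: greaterThanLessThan_def elim: eventually_mono)
    then show "\<forall>\<^sub>F r in at_right 0. 0 \<le> (1 / \<sigma> * (ts - u) * (u - t) - (f u - f ts)) * r
        + (1 / (2 * \<sigma>) * (ts - u)\<^sup>2) * r\<^sup>2"
    proof eventually_elim
      case (elim r)
      have "f ((1 - r) * u + r * ts) \<le> (1 - r) * f u + r * f ts"
        using convex_onD[OF conv, of r u ts] elim by simp
      moreover have "1 / (2 * \<sigma>) * (((1 - r) * u + r * ts) - t)\<^sup>2 - 1 / (2 * \<sigma>) * (u - t)\<^sup>2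
          = 1 / \<sigma> * (ts - u) * (u - t) * r + 1 / (2 * \<sigma>) * (ts - u)\<^sup>2 * r\<^sup>2"
        using assms(1) by (simp add: field_simps power2_eq_square)
      ultimately show ?case
        using le[of "(1 - r) * u + r * ts"] by (simp add: algebra_simps)
    qed
  qed
  then have "c * (ts - u)\<^sup>2 \<le> 1 / \<sigma> * (ts - u) * (u - t)"
    using growth[of u] u unfolding u_def[symmetric] by linarith
  then have "(ts - u) * (c * \<sigma> * (ts - u)) \<le> (ts - u) * (u - t)"
    using assms(1) by (simp add: field_simps power2_eq_square)
  then have "ts = u \<or> c * \<sigma> * (ts - u) \<le> u - t"
    using u unfolding u_def[symmetric] by (auto simp: mult_le_cancel_left)
  then show "(1 + c * \<sigma>) * (ts - prox \<sigma> f t) \<le> ts - t"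
    using assms(2) unfolding u_def[symmetric] by (auto simp: algebra_simps)
qed

end


section \<open>The inexact iteration\<close>

text \<open>This is where the exponent being at least 1 enters: the tolerance is at most
  \<open>\<epsilon> k\<close> times the step length, so it can be absorbed into the
  contraction.\<close>

lemma min_1_powr_le:
  fixes x \<nu> :: real
  assumes "x \<ge> 0" "\<nu> \<ge> 1"
  shows "min 1 (x powr \<nu>) \<le> x"
proof (cases "x \<le> 1")
  case True
  then show ?thesis
    using powr_mono'[of 1 \<nu> x] assms by simp
qed simp

text \<open>\<open>P k\<close> stands for the exact proximal map, of which only its fixed points
  right of \<open>ts\<close> and its contraction factor \<open>\<rho> k\<close> left of
  \<open>ts\<close> matter. One rate covers both the case of stopping beyond \<open>ts\<close> and
  that of approaching it from the left.\<close>

lemma inexact_contraction_converges: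
  fixes t :: "nat \<Rightarrow> real" and P :: "nat \<Rightarrow> real \<Rightarrow> real"
  assumes eps: "\<And>k. \<epsilon> k \<ge> 0" "summable \<epsilon>" and "\<nu> \<ge> 1"
    and step: "\<And>k. \<bar>t (Suc k) - P k (t k)\<bar> \<le> error_bound \<epsilon> \<nu> t k"
    and above: "\<And>k u. ts \<le> u \<Longrightarrow> P k u = u"
    and below: "\<And>k u. u \<le> ts \<Longrightarrow> P k u \<le> ts" "\<And>k u. u \<le> ts \<Longrightarrow> ts - P k u \<le> \<rho> k * (ts - u)"
    and \<rho>: "\<And>k. 0 \<le> \<rho> k" "\<And>k. \<rho> k \<le> r" "r < 1"
    and "t 0 \<le> ts"
  shows "\<exists>\<tau>\<in>{ts .. ts + (\<Sum>k. error_bound \<epsilon> \<nu> t k)}. t \<longlonglongrightarrow> \<tau> \<and>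
    (\<forall>\<^sub>F k in sequentially. \<bar>t (Suc k) - \<tau>\<bar> \<le> (\<rho> k + \<epsilon> k) / (1 - \<epsilon> k) * \<bar>t k - \<tau>\<bar>)"
proof -
  define e where "e = error_bound \<epsilon> \<nu> t"
  have e0: "0 \<le> e k" for k
    using eps by (simp add: e_def error_bound_def)
  have e_le: "e k \<le> \<epsilon> k" for k
    using mult_left_mono[of "min 1 (\<bar>t (Suc k) - t k\<bar> powr \<nu>)" 1 "\<epsilon> k"] eps(1)[of k]
    by (simp add: e_def error_bound_def)
  have e_step: "e k \<le> \<epsilon> k * \<bar>t (Suc k) - t k\<bar>" for k
    unfolding e_def error_bound_def
    by (intro mult_left_mono min_1_powr_le eps) (use \<open>\<nu> \<ge> 1\<close> in auto)
  have sum_e: "summable e"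
    by (rule summable_comparison_test'[OF eps(2), of 0]) (use e0 e_le in auto)
  have step': "\<bar>t (Suc k) - P k (t k)\<bar> \<le> e k" for k
    using step by (simp add: e_def)
  \<comment> \<open>Exact steps neither cross \<open>ts\<close> from the left nor move points on its
    right, so only the errors can carry the sequence beyond \<open>ts\<close>.\<close>
  have drift: "t k \<le> ts + sum e {..<k}" for k
  proof (induction k)
    case (Suc k)
    have "0 \<le> sum e {..<k}"
      using e0 by (simp add: sum_nonneg)
    moreover have "P k (t k) \<le> t k \<or> P k (t k) \<le> ts"
      using above[of "t k" k] below(1)[of "t k" k] by linarith
    ultimately show ?case
      using Suc step'[of k] by auto
  qed (use \<open>t 0 \<le> ts\<close> in simp)
  have lam: "sum e {..<k} \<le> suminf e" for k
    by (rule sum_le_suminf[OF sum_e]) (use e0 in auto)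
  have "\<epsilon> \<longlonglongrightarrow> 0"
    using eps(2) by (rule summable_LIMSEQ_zero)
  then have lim: "(\<lambda>k. (r + \<epsilon> k) / (1 - \<epsilon> k)) \<longlonglongrightarrow> (r + 0) / (1 - 0)"
    by (intro tendsto_intros) auto
  have "r \<ge> 0"
    using \<rho>(1)[of 0] \<rho>(2)[of 0] by linarith
  \<comment> \<open>Any number strictly between \<open>r\<close>, the limit of
    \<open>(r + \<epsilon> k) / (1 - \<epsilon> k)\<close>, and 1 would do; it is the ratio of the
    geometric decay below.\<close>
  define s where "s = (1 + r) / 2"
  have s: "0 \<le> s" "s < 1" "r < s"
    using \<open>r < 1\<close> \<open>r \<ge> 0\<close> by (auto simp: s_def)
  have "\<forall>\<^sub>F k in sequentially. \<epsilon> k < 1 \<and> (r + \<epsilon> k) / (1 - \<epsilon> k) < s"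
    using order_tendstoD(2)[OF \<open>\<epsilon> \<longlonglongrightarrow> 0\<close>, of 1] order_tendstoD(2)[OF lim, of s] s
    by (auto intro: eventually_conj)
  then obtain K where K: "\<And>k. k \<ge> K \<Longrightarrow> \<epsilon> k < 1" "\<And>k. k \<ge> K \<Longrightarrow> (r + \<epsilon> k) / (1 - \<epsilon> k) < s"
    unfolding eventually_sequentially by blast
  show ?thesis
  proof (cases "\<exists>k\<ge>K. ts \<le> t k")
    case True
    then obtain k0 where k0: "k0 \<ge> K" "ts \<le> t k0" by blast
    have const: "t (k0 + n) = t k0" for n
    proof (induction n)
      case (Suc n)
      let ?k = "k0 + n"
      have "P ?k (t ?k) = t ?k"
        using above k0 Suc by simp
      then have "\<bar>t (Suc ?k) - t ?k\<bar> \<le> \<epsilon> ?k * \<bar>t (Suc ?k) - t ?k\<bar>"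
        using step'[of ?k] e_step[of ?k] by simp
      then have "(1 - \<epsilon> ?k) * \<bar>t (Suc ?k) - t ?k\<bar> \<le> 0"
        by (simp add: algebra_simps)
      then have "t (Suc ?k) = t ?k"
        using K(1)[of ?k] k0 by (auto simp: mult_le_0_iff)
      then show ?case using Suc by simp
    qed simp
    then have const': "t k = t k0" if "k \<ge> k0" for k
      using const[of "k - k0"] that by simp
    then have "\<forall>\<^sub>F k in sequentially. t k = t k0"
      unfolding eventually_sequentially by blast
    then have "t \<longlonglongrightarrow> t k0"
      by (rule tendsto_eventually)
    \<comment> \<open>Both distances are 0 from \<open>k0\<close> on, so the bound holds whatever
      the factor is.\<close>
    moreover have "\<forall>\<^sub>F k in sequentially. \<bar>t (Suc k) - t k0\<bar> \<le> (\<rho> k + \<epsilon> k) / (1 - \<epsilon> k) * \<bar>t k - t k0\<bar>"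
      unfolding eventually_sequentially
    proof (intro exI allI impI)
      fix k assume "k \<ge> k0"
      then show "\<bar>t (Suc k) - t k0\<bar> \<le> (\<rho> k + \<epsilon> k) / (1 - \<epsilon> k) * \<bar>t k - t k0\<bar>"
        using const'[OF \<open>k \<ge> k0\<close>] const'[OF le_SucI[OF \<open>k \<ge> k0\<close>]]
        by (simp only: diff_self abs_zero mult_zero_right order_refl)
    qed
    moreover have "t k0 \<in> {ts .. ts + suminf e}"
      using k0 drift[of k0] lam[of k0] by auto
    ultimately show ?thesis
      unfolding e_def by blast
  next
    case False
    define d where "d k = ts - t k" for k
    have d0: "0 \<le> d k" if "k \<ge> K" for k
      using False that by (force simp: d_def)
    have rate: "d (Suc k) \<le> (\<rho> k + \<epsilon> k) / (1 - \<epsilon> k) * d k" if "k \<ge> K" for k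
    proof -
      have "ts - P k (t k) \<le> \<rho> k * d k"
        using below(2)[of "t k" k] d0[OF that] by (simp add: d_def)
      then have "d (Suc k) \<le> \<rho> k * d k + \<epsilon> k * \<bar>t (Suc k) - t k\<bar>"
        using step'[of k] e_step[of k] unfolding d_def by linarith
      \<comment> \<open>Bounding the step by both distances puts an
        \<open>\<epsilon> k * d (Suc k)\<close> on the right; moving it to the left produces the
        denominator \<open>1 - \<epsilon> k\<close>.\<close>
      moreover have "\<bar>t (Suc k) - t k\<bar> \<le> d k + d (Suc k)"
        using d0[of k] d0[of "Suc k"] that by (simp add: d_def)
      then have "\<epsilon> k * \<bar>t (Suc k) - t k\<bar> \<le> \<epsilon> k * (d k + d (Suc k))"
        using eps(1) by (rule mult_left_mono)
      ultimately have "d (Suc k) \<le> \<rho> k * d k + \<epsilon> k * (d k + d (Suc k))"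
        by linarith
      then have "d (Suc k) * (1 - \<epsilon> k) \<le> (\<rho> k + \<epsilon> k) * d k"
        by (simp add: algebra_simps)
      then have "d (Suc k) \<le> (\<rho> k + \<epsilon> k) * d k / (1 - \<epsilon> k)"
        using K(1)[OF that] by (subst pos_le_divide_eq) simp_all
      then show ?thesis
        by simp
    qed
    have geo: "d (K + n) \<le> s ^ n * d K" for n
    proof (induction n)
      case (Suc n)
      have "(\<rho> (K + n) + \<epsilon> (K + n)) / (1 - \<epsilon> (K + n)) \<le> (r + \<epsilon> (K + n)) / (1 - \<epsilon> (K + n))"
        using K(1)[of "K + n"] \<rho>(2) by (intro divide_right_mono) auto
      then have "d (Suc (K + n)) \<le> s * d (K + n)"
        using rate[of "K + n"] K(2)[of "K + n"] d0[of "K + n"]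
        by (smt (verit) le_add1 mult_right_mono)
      also have "\<dots> \<le> s * (s ^ n * d K)"
        using Suc s by (simp add: mult_left_mono)
      finally show ?case by simp
    qed simp
    have "(\<lambda>n. s ^ n * d K) \<longlonglongrightarrow> 0 * d K"
      using s by (intro tendsto_mult LIMSEQ_realpow_zero tendsto_const) auto
    then have upper: "(\<lambda>n. s ^ n * d K) \<longlonglongrightarrow> 0"
      by simp
    have "\<forall>\<^sub>F n in sequentially. d (n + K) \<le> s ^ n * d K"
      using geo by (simp add: add.commute)
    moreover have "\<forall>\<^sub>F n in sequentially. 0 \<le> d (n + K)"
      using d0 by simp
    ultimately have "(\<lambda>n. d (n + K)) \<longlonglongrightarrow> 0"
      by (rule tendsto_sandwich[rotated, OF _ tendsto_const upper])
    then have "d \<longlonglongrightarrow> 0"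
      by (rule LIMSEQ_offset)
    then have "(\<lambda>k. ts - d k) \<longlonglongrightarrow> ts - 0"
      by (intro tendsto_intros)
    then have "t \<longlonglongrightarrow> ts"
      by (simp add: d_def)
    moreover have "\<forall>\<^sub>F k in sequentially. \<bar>t (Suc k) - ts\<bar> \<le> (\<rho> k + \<epsilon> k) / (1 - \<epsilon> k) * \<bar>t k - ts\<bar>"
      unfolding eventually_sequentially
    proof (intro exI allI impI)
      fix k assume "k \<ge> K"
      then have "\<bar>t (Suc k) - ts\<bar> = d (Suc k)" "\<bar>t k - ts\<bar> = d k"
        using d0[of k] d0[of "Suc k"] by (auto simp: d_def)
      then show "\<bar>t (Suc k) - ts\<bar> \<le> (\<rho> k + \<epsilon> k) / (1 - \<epsilon> k) * \<bar>t k - ts\<bar>"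
        using rate[OF \<open>k \<ge> K\<close>] by simp
    qed
    moreover have "ts \<in> {ts .. ts + suminf e}"
      using lam[of 0] by simp
    ultimately show ?thesis
      unfolding e_def by blast
  qed
qed

section \<open>The residual with the slack eliminated\<close>

text \<open>The minimum of \<open>residual\<close> over the slack. For \<open>u > 0\<close> the
  least value of \<open>(u + s)\<^sup>2 + (max (- s) 0)\<^sup>2\<close> is
  \<open>u\<^sup>2 / 2\<close>, whence the weight 1/4.\<close>

definition reduced_residual ::
  "real^'n^'n \<Rightarrow> real^'n \<Rightarrow> real^'n^'m \<Rightarrow> real^'m \<Rightarrow> real^'n \<Rightarrow> real \<Rightarrow> real" where
  "reduced_residual Q p A b x t =
     1 / 2 * (max (quad_obj Q p x - t) 0)\<^sup>2 + 1 / 4 * (norm (pos_part (A *v x - b)))\<^sup>2"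

text \<open>A satisfied constraint is closed at no cost; a violated one is split evenly between the
  equation error and the negativity of the slack.\<close>

definition best_slack :: "real^'m \<Rightarrow> real^'m" where
  "best_slack v = (\<chi> i. if v $ i \<le> 0 then - v $ i else - v $ i / 2)"

lemma pos_part_nth [simp]: "pos_part v $ i = max (v $ i) 0"
  by (simp add: pos_part_def)

lemma norm_vec_power2: "(norm (v :: real^'m))\<^sup>2 = (\<Sum>i\<in>UNIV. (v $ i)\<^sup>2)"
  unfolding power2_norm_eq_inner inner_vec_def inner_real_def by (simp only: power2_eq_square)

lemma slack_cost_ge:
  fixes u s :: real
  shows "(max u 0)\<^sup>2 / 2 \<le> (u + s)\<^sup>2 + (max (- s) 0)\<^sup>2"
proof (cases "u \<le> 0")
  case False
  show ?thesis
  proof (cases "s \<le> 0")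
    case True
    \<comment> \<open>Completing the square, which vanishes at the even split
      \<open>s = - u / 2\<close>.\<close>
    have "(u + s)\<^sup>2 + s\<^sup>2 - u\<^sup>2 / 2 = (u + 2 * s)\<^sup>2 / 2"
      by (simp add: power2_eq_square algebra_simps)
    also have "\<dots> \<ge> 0"
      by simp
    finally show ?thesis
      using True False by simp
  next
    case s: False
    have "u\<^sup>2 \<le> (u + s)\<^sup>2"
      using False s by (intro power_mono) auto
    then have "u\<^sup>2 / 2 \<le> (u + s)\<^sup>2"
      using zero_le_power2[of u] by linarith
    moreover have "max u 0 = u" "max (- s) 0 = 0"
      using False s by auto
    ultimately show ?thesis
      by simp
  qed
qed (simp add: max_absorb2)

lemma residual_ge_reduced: "reduced_residual Q p A b x t \<le> residual Q p A b x s t"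
proof -
  have "(\<Sum>i\<in>UNIV. (max ((A *v x - b) $ i) 0)\<^sup>2 / 2)
      \<le> (\<Sum>i\<in>UNIV. ((A *v x - b) $ i + s $ i)\<^sup>2 + (max (- s $ i) 0)\<^sup>2)"
    by (intro sum_mono slack_cost_ge)
  then have "(norm (pos_part (A *v x - b)))\<^sup>2 / 2 \<le> (norm (A *v x + s - b))\<^sup>2 + (norm (pos_part (- s)))\<^sup>2"
    by (simp add: norm_vec_power2 sum.distrib sum_divide_distrib algebra_simps)
  then show ?thesis
    by (simp add: residual_def reduced_residual_def)
qed

lemma residual_best_slack:
  "residual Q p A b x (best_slack (A *v x - b)) t = reduced_residual Q p A b x t"
proof -
  let ?s = "best_slack (A *v x - b)"
  have slack: "(u + (if u \<le> 0 then - u else - u / 2))\<^sup>2 + (max (- (if u \<le> 0 then - u else - u / 2)) 0)\<^sup>2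
      = (max u 0)\<^sup>2 / 2" for u :: real
    by (auto simp: power2_eq_square max_def field_simps)
  have "(\<Sum>i\<in>UNIV. ((A *v x - b) $ i + ?s $ i)\<^sup>2 + (max (- ?s $ i) 0)\<^sup>2)
      = (\<Sum>i\<in>UNIV. (max ((A *v x - b) $ i) 0)\<^sup>2 / 2)"
    unfolding best_slack_def vec_lambda_beta slack ..
  moreover have "A *v x + ?s - b = (A *v x - b) + ?s"
    by simp
  ultimately have "(norm (A *v x + ?s - b))\<^sup>2 + (norm (pos_part (- ?s)))\<^sup>2
      = (norm (pos_part (A *v x - b)))\<^sup>2 / 2"
    by (simp add: norm_vec_power2 sum.distrib sum_divide_distrib algebra_simps)
  then show ?thesis
    by (simp add: residual_def reduced_residual_def)
qed

text \<open>The squared positive part is convex and nondecreasing. The hypothesis is an inequality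
  so that the lemma serves the convex \<open>q\<close> as well as the affine constraints.\<close>

lemma pos_sq_convex:
  fixes z u w r :: real
  assumes "z \<le> (1 - r) * u + r * w" "0 \<le> r" "r \<le> 1"
  shows "(max z 0)\<^sup>2 \<le> (1 - r) * (max u 0)\<^sup>2 + r * (max w 0)\<^sup>2"
proof -
  let ?u = "max u 0" and ?w = "max w 0"
  have "(1 - r) * u \<le> (1 - r) * ?u" "r * w \<le> r * ?w" "0 \<le> (1 - r) * ?u" "0 \<le> r * ?w"
    using assms by (auto intro: mult_left_mono)
  then have "max z 0 \<le> (1 - r) * ?u + r * ?w"
    using assms(1) by linarith
  then have "(max z 0)\<^sup>2 \<le> ((1 - r) * ?u + r * ?w)\<^sup>2"
    by (intro power_mono) auto
  also have "\<dots> = (1 - r) * ?u\<^sup>2 + r * ?w\<^sup>2 - r * (1 - r) * (?u - ?w)\<^sup>2"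
    by (simp add: power2_eq_square algebra_simps)
  also have "\<dots> \<le> (1 - r) * ?u\<^sup>2 + r * ?w\<^sup>2"
    using assms by simp
  finally show ?thesis .
qed

lemma violation_convex:
  fixes A :: "real^'n^'m"
  assumes "0 \<le> r" "r \<le> 1"
  shows "(norm (pos_part (A *v ((1 - r) *\<^sub>R x + r *\<^sub>R y) - b)))\<^sup>2
    \<le> (1 - r) * (norm (pos_part (A *v x - b)))\<^sup>2 + r * (norm (pos_part (A *v y - b)))\<^sup>2"
proof -
  have "A *v ((1 - r) *\<^sub>R x + r *\<^sub>R y) - b = (1 - r) *\<^sub>R (A *v x - b) + r *\<^sub>R (A *v y - b)"
    by (simp add: matrix_vector_right_distrib matrix_vector_mult_scaleR algebra_simps)
  then have "(max ((A *v ((1 - r) *\<^sub>R x + r *\<^sub>R y) - b) $ i) 0)\<^sup>2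
      \<le> (1 - r) * (max ((A *v x - b) $ i) 0)\<^sup>2 + r * (max ((A *v y - b) $ i) 0)\<^sup>2" for i
    using assms by (intro pos_sq_convex) auto
  then show ?thesis
    unfolding norm_vec_power2 pos_part_nth sum_distrib_left sum.distrib[symmetric]
    by (rule sum_mono)
qed

text \<open>Comparing with the positive part allows a satisfied constraint to lose slack as long as
  it stays satisfied.\<close>

lemma violation_mono:
  assumes "\<And>i. v $ i \<le> max (w $ i) 0"
  shows "(norm (pos_part v))\<^sup>2 \<le> (norm (pos_part w))\<^sup>2"
  unfolding norm_vec_power2 pos_part_nth
  by (intro sum_mono power_mono) (use assms in simp_all)

lemma continuous_on_violation:
  fixes A :: "real^'n^'m"
  shows "continuous_on S (\<lambda>x. (norm (pos_part (A *v x - b)))\<^sup>2)"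
  unfolding pos_part_def by (intro continuous_intros)

section \<open>Convexity of the objective and of the reduced residual\<close>

context
  fixes Q :: "real^'n^'n" and p :: "real^'n"
  assumes symmetric: "transpose Q = Q"
    and psd: "\<forall>x. x \<bullet> (Q *v x) \<ge> 0"
begin

lemma quad_obj_along:
  "quad_obj Q p (x + r *\<^sub>R d)
   = quad_obj Q p x + r * ((Q *v x + p) \<bullet> d) + r\<^sup>2 / 2 * (d \<bullet> (Q *v d))"
proof -
  have "x \<bullet> (Q *v d) = (Q *v x) \<bullet> d"
    using symmetric by (metis dot_lmul_matrix vector_transpose_matrix)
  moreover have "d \<bullet> (Q *v x) = (Q *v x) \<bullet> d"
    by (rule inner_commute)
  ultimately show ?thesis
    by (simp add: quad_obj_def matrix_vector_right_distrib matrix_vector_mult_scaleR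
        inner_add_left inner_add_right power2_eq_square algebra_simps)
qed

lemma quad_obj_ge_tangent: "quad_obj Q p x + (Q *v x + p) \<bullet> (y - x) \<le> quad_obj Q p y"
  using quad_obj_along[of x 1 "y - x"] psd[rule_format, of "y - x"] by simp

lemma quad_obj_convex:
  assumes "0 \<le> r" "r \<le> 1"
  shows "quad_obj Q p ((1 - r) *\<^sub>R x + r *\<^sub>R y) \<le> (1 - r) * quad_obj Q p x + r * quad_obj Q p y"
proof -
  define d g D where "d = y - x" and "g = (Q *v x + p) \<bullet> d" and "D = d \<bullet> (Q *v d)"
  have "(1 - r) *\<^sub>R x + r *\<^sub>R y = x + r *\<^sub>R d"
    by (simp add: d_def algebra_simps)
  then have 1: "quad_obj Q p ((1 - r) *\<^sub>R x + r *\<^sub>R y) = quad_obj Q p x + r * g + r\<^sup>2 / 2 * D"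
    using quad_obj_along[of x r d] by (simp add: g_def D_def)
  have 2: "quad_obj Q p y = quad_obj Q p x + g + D / 2"
    using quad_obj_along[of x 1 d] by (simp add: g_def D_def d_def)
  have "0 \<le> r * (1 - r) * D / 2"
    using assms psd by (simp add: D_def)
  then show ?thesis
    unfolding 1 2 by (simp add: algebra_simps power2_eq_square)
qed

text \<open>Semidefiniteness tested at \<open>d - r *\<^sub>R y\<close> with
  \<open>y = Q *v d\<close> leaves a linear term \<open>- 2 * (y \<bullet> y) * r\<close>, which
  must not be negative for small \<open>r > 0\<close>.\<close>

lemma psd_kernel:
  assumes "d \<bullet> (Q *v d) = 0"
  shows "Q *v d = 0"
proof -
  define y where "y = Q *v d"
  have sym: "d \<bullet> (Q *v y) = y \<bullet> y"
    using symmetric by (metis dot_lmul_matrix vector_transpose_matrix y_def)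
  have "0 \<le> (- 2 * (y \<bullet> y)) * r + (y \<bullet> (Q *v y)) * r\<^sup>2" for r
  proof -
    have "0 \<le> (d - r *\<^sub>R y) \<bullet> (Q *v (d - r *\<^sub>R y))"
      using psd by blast
    also have "\<dots> = (- 2 * (y \<bullet> y)) * r + (y \<bullet> (Q *v y)) * r\<^sup>2"
      using assms sym
      by (simp add: matrix_vector_mult_diff_distrib matrix_vector_mult_scaleR inner_diff_left
          inner_diff_right power2_eq_square algebra_simps flip: y_def)
    finally show ?thesis .
  qed
  then have "0 \<le> - 2 * (y \<bullet> y)"
    by (intro linear_coeff_nonneg[where c = "y \<bullet> (Q *v y)"]) simp
  then have "y \<bullet> y = 0"
    using inner_ge_zero[of y] by linarith
  then show ?thesis
    by (simp add: y_def)
qed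

lemma reduced_residual_convex:
  fixes A :: "real^'n^'m"
  assumes "0 \<le> r" "r \<le> 1"
  shows "reduced_residual Q p A b ((1 - r) *\<^sub>R x + r *\<^sub>R y) ((1 - r) * t + r * t')
    \<le> (1 - r) * reduced_residual Q p A b x t + r * reduced_residual Q p A b y t'"
proof -
  let ?z = "(1 - r) *\<^sub>R x + r *\<^sub>R y"
  have "quad_obj Q p ?z - ((1 - r) * t + r * t') \<le> (1 - r) * (quad_obj Q p x - t) + r * (quad_obj Q p y - t')"
    using quad_obj_convex[OF assms, of x y] by (simp add: algebra_simps)
  from pos_sq_convex[OF this assms] violation_convex[OF assms, of A x y b]
  show ?thesis
    unfolding reduced_residual_def by (simp add: algebra_simps diff_divide_distrib)
qed

lemma continuous_on_reduced_residual:
  fixes A :: "real^'n^'m"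
  shows "continuous_on S (\<lambda>x. reduced_residual Q p A b x t)"
  unfolding reduced_residual_def quad_obj_def
  by (intro continuous_intros continuous_on_violation)

text \<open>An interior minimum over a ball is a local one, hence global by convexity. So if there
  is no global minimiser, ball minimisers must lie on the sphere.\<close>

lemma reduced_residual_interior_min:
  fixes A :: "real^'n^'m"
  assumes z: "norm z < R"
    and min: "\<And>x. norm x \<le> R \<Longrightarrow> reduced_residual Q p A b z t \<le> reduced_residual Q p A b x t"
  shows "reduced_residual Q p A b z t \<le> reduced_residual Q p A b x t"
proof -
  have "convex_on UNIV (\<lambda>x. reduced_residual Q p A b x t)"
  proof (rule convex_onI)
    fix r :: real and x y assume "0 < r" "r < 1"
    then show "reduced_residual Q p A b ((1 - r) *\<^sub>R x + r *\<^sub>R y) t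
        \<le> (1 - r) * reduced_residual Q p A b x t + r * reduced_residual Q p A b y t"
      using reduced_residual_convex[of r A b x y t t] by (simp add: algebra_simps)
  qed simp
  moreover have "\<forall>y\<in>ball z (R - norm z). reduced_residual Q p A b z t \<le> reduced_residual Q p A b y t"
  proof
    fix y assume "y \<in> ball z (R - norm z)"
    then have "norm y \<le> R"
      using norm_triangle_ineq2[of y z] by (simp add: dist_norm norm_minus_commute)
    then show "reduced_residual Q p A b z t \<le> reduced_residual Q p A b y t"
      by (rule min)
  qed
  ultimately show ?thesis
    using convex_local_global_minimum[of "R - norm z" UNIV "\<lambda>x. reduced_residual Q p A b x t" z] z
    by simp
qed

end

section \<open>Attainment and Lagrange multipliers\<close>

lemma violation_nth_le: "v $ i \<le> norm (pos_part v)"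
  using component_le_norm_cart[of "pos_part v" i] by simp

text \<open>Minimisers over growing balls that stay on the boundary have a limiting direction along which
  the residual does not increase; stepping back along it gives a minimiser in the interior.\<close>

lemma reduced_residual_attained_no_descent:
  fixes A :: "real^'n^'m"
  assumes symmetric: "transpose Q = Q" and psd: "\<forall>x. x \<bullet> (Q *v x) \<ge> 0"
    and no_descent: "\<And>d. Q *v d = 0 \<Longrightarrow> p \<bullet> d \<le> 0 \<Longrightarrow> (\<And>i. A $ i \<bullet> d \<le> 0) \<Longrightarrow> p \<bullet> d = 0"
  shows "\<exists>z. \<forall>x. reduced_residual Q p A b z t \<le> reduced_residual Q p A b x t"
proof (rule ccontr)
  assume none: "\<not> ?thesis"
  define h where "h x = reduced_residual Q p A b x t" for x
  have no_interior: "\<not> (norm z < R \<and> (\<forall>x. norm x \<le> R \<longrightarrow> h z \<le> h x))" for z R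
    using reduced_residual_interior_min[OF symmetric psd, of z R p A b t] none unfolding h_def by blast
  have "\<exists>y. norm y \<le> real k \<and> (\<forall>x. norm x \<le> real k \<longrightarrow> h y \<le> h x)" for k
  proof -
    have "cball (0 :: real^'n) (real k) \<noteq> {}"
      by simp
    moreover have "continuous_on (cball 0 (real k)) h"
      unfolding h_def by (rule continuous_on_reduced_residual[OF symmetric psd])
    ultimately obtain y where "y \<in> cball 0 (real k)" "\<forall>x\<in>cball 0 (real k). h y \<le> h x"
      using continuous_attains_inf[OF compact_cball] by blast
    then show ?thesis
      by (intro exI[of _ y]) simp
  qed
  then obtain Y where Y: "\<And>k. norm (Y k) \<le> real k" "\<And>k x. norm x \<le> real k \<Longrightarrow> h (Y k) \<le> h x"
    by metis
  have norm_Y: "norm (Y k) = real k" for k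
  proof -
    have "\<not> norm (Y k) < real k"
      using Y(2) no_interior by blast
    with Y(1)[of k] show ?thesis
      by linarith
  qed
  \<comment> \<open>\<open>Suc k\<close> keeps the radius positive. The normalised minimisers lie on
    the unit sphere, so a subsequence converges to a direction \<open>d\<close>.\<close>
  define u where "u k = Y (Suc k) /\<^sub>R real (Suc k)" for k
  have "u k \<in> sphere 0 1" for k
    by (simp add: u_def norm_Y del: of_nat_Suc)
  then obtain d r where d: "d \<in> sphere 0 1" and "strict_mono r" and lim: "(u \<circ> r) \<longlonglongrightarrow> d"
    using seq_compactE[OF compact_imp_seq_compact[OF compact_sphere], of u 0 1] by blast
  define v y \<kappa> \<iota> where "v j = u (r j)" and "y j = Y (Suc (r j))" and "\<kappa> j = real (Suc (r j))"
    and "\<iota> j = inverse (\<kappa> j)" for j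
  have \<kappa>: "\<kappa> j > 0" "\<iota> j > 0" "\<iota> j * \<kappa> j = 1" for j
    by (simp_all add: \<kappa>_def \<iota>_def del: of_nat_Suc)
  have y_v: "v j = \<iota> j *\<^sub>R y j" for j
    by (simp add: v_def u_def y_def \<iota>_def \<kappa>_def)
  have v: "v \<longlonglongrightarrow> d"
    using lim by (simp add: v_def[abs_def] o_def)
  have \<iota>: "\<iota> \<longlonglongrightarrow> 0"
    using LIMSEQ_subseq_LIMSEQ[OF LIMSEQ_inverse_real_of_nat \<open>strict_mono r\<close>]
    by (simp add: \<iota>_def[abs_def] \<kappa>_def o_def del: of_nat_Suc)
  \<comment> \<open>The origin lies in every ball, so \<open>h 0\<close> bounds the residual at all
    ball minimisers, and with it \<open>q\<close> and the constraint values along them.\<close>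
  define C where "C = h 0"
  have le_C: "h (y j) \<le> C" for j
    unfolding C_def y_def by (rule Y) simp
  have C_parts: "1 / 2 * (max (quad_obj Q p (y j) - t) 0)\<^sup>2 \<le> C"
    "1 / 4 * (norm (pos_part (A *v y j - b)))\<^sup>2 \<le> C" for j
    using le_C[of j] zero_le_power2[of "max (quad_obj Q p (y j) - t) 0"]
      zero_le_power2[of "norm (pos_part (A *v y j - b))"]
    unfolding h_def reduced_residual_def by linarith+
  define M where "M = t + sqrt (2 * C)"
  have q_le: "quad_obj Q p (y j) \<le> M" for j
  proof -
    have "max (quad_obj Q p (y j) - t) 0 \<le> sqrt (2 * C)"
      using C_parts(1)[of j] by (intro real_le_rsqrt) linarith
    then show ?thesis
      by (simp add: M_def)
  qed
  have A_le: "A $ i \<bullet> y j \<le> b $ i + sqrt (4 * C)" for i j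
  proof -
    have "norm (pos_part (A *v y j - b)) \<le> sqrt (4 * C)"
      using C_parts(2)[of j] by (intro real_le_rsqrt) linarith
    then show ?thesis
      using violation_nth_le[of "A *v y j - b" i] by (simp add: matrix_vector_mul_component)
  qed
  \<comment> \<open>Scaling \<open>quad_obj Q p (y j) \<le> M\<close> by
    \<open>(\<iota> j)\<^sup>2\<close> leaves only the quadratic form of \<open>d\<close> in the
    limit.\<close>
  have "(\<lambda>j. 1 / 2 * (v j \<bullet> (Q *v v j)) + \<iota> j * (p \<bullet> v j)) \<longlonglongrightarrow> 1 / 2 * (d \<bullet> (Q *v d)) + 0 * (p \<bullet> d)"
    by (intro tendsto_intros v \<iota> bounded_linear.tendsto[OF matrix_vector_mul_bounded_linear])
  moreover have "(\<lambda>j. M * (\<iota> j)\<^sup>2) \<longlonglongrightarrow> M * 0\<^sup>2"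
    by (intro tendsto_intros \<iota>)
  moreover have "1 / 2 * (v j \<bullet> (Q *v v j)) + \<iota> j * (p \<bullet> v j) \<le> M * (\<iota> j)\<^sup>2" for j
  proof -
    have "1 / 2 * (v j \<bullet> (Q *v v j)) + \<iota> j * (p \<bullet> v j) = quad_obj Q p (y j) * (\<iota> j)\<^sup>2"
      by (simp add: y_v quad_obj_def matrix_vector_mult_scaleR power2_eq_square algebra_simps)
    then show ?thesis
      using q_le[of j] by (simp add: mult_right_mono)
  qed
  ultimately have "1 / 2 * (d \<bullet> (Q *v d)) + 0 * (p \<bullet> d) \<le> M * 0\<^sup>2"
    by (intro LIMSEQ_le) auto
  then have "d \<bullet> (Q *v d) = 0"
    using psd[rule_format, of d] by simp
  then have Qd: "Q *v d = 0"
    by (rule psd_kernel[OF symmetric psd])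
  have "(\<lambda>j. p \<bullet> v j) \<longlonglongrightarrow> p \<bullet> d"
    by (intro tendsto_intros v)
  moreover have "(\<lambda>j. M * \<iota> j) \<longlonglongrightarrow> M * 0"
    by (intro tendsto_intros \<iota>)
  moreover have "p \<bullet> v j \<le> M * \<iota> j" for j
  proof -
    have "p \<bullet> y j \<le> M"
      using q_le[of j] psd[rule_format, of "y j"] by (simp add: quad_obj_def)
    then show ?thesis
      using \<kappa>(2)[of j] by (simp add: y_v mult.commute)
  qed
  ultimately have "p \<bullet> d \<le> M * 0"
    by (intro LIMSEQ_le) auto
  moreover have Ad: "A $ i \<bullet> d \<le> 0" for i
  proof -
    have "(\<lambda>j. A $ i \<bullet> v j) \<longlonglongrightarrow> A $ i \<bullet> d"
      by (intro tendsto_intros v)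
    moreover have "(\<lambda>j. (b $ i + sqrt (4 * C)) * \<iota> j) \<longlonglongrightarrow> (b $ i + sqrt (4 * C)) * 0"
      by (intro tendsto_intros \<iota>)
    moreover have "A $ i \<bullet> v j \<le> (b $ i + sqrt (4 * C)) * \<iota> j" for j
      using mult_left_mono[OF A_le[of i j], of "\<iota> j"] \<kappa>(2)[of j] by (simp add: y_v mult.commute)
    ultimately have "A $ i \<bullet> d \<le> (b $ i + sqrt (4 * C)) * 0"
      by (intro LIMSEQ_le) auto
    then show ?thesis by simp
  qed
  ultimately have pd: "p \<bullet> d = 0"
    using no_descent[OF Qd] by simp
  \<comment> \<open>A row orthogonal to \<open>d\<close> is unaffected by the step back. On any
    other row \<open>A $ i \<bullet> d < 0\<close>, so its value at \<open>y j\<close> falls without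
    bound and eventually leaves room for the step.\<close>
  have "\<forall>\<^sub>F j in sequentially. (A *v (y j - d) - b) $ i \<le> max ((A *v y j - b) $ i) 0" for i
  proof (cases "A $ i \<bullet> d = 0")
    case True
    then show ?thesis
      by (simp add: matrix_vector_mul_component inner_diff_right)
  next
    case False
    have "(\<lambda>j. A $ i \<bullet> v j - (b $ i + A $ i \<bullet> d) * \<iota> j) \<longlonglongrightarrow> A $ i \<bullet> d - (b $ i + A $ i \<bullet> d) * 0"
      by (intro tendsto_intros v \<iota>)
    moreover have "A $ i \<bullet> d - (b $ i + A $ i \<bullet> d) * 0 < 0"
      using False Ad[of i] by simp
    ultimately have "\<forall>\<^sub>F j in sequentially. A $ i \<bullet> v j - (b $ i + A $ i \<bullet> d) * \<iota> j < 0"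
      by (rule order_tendstoD)
    then show ?thesis
    proof eventually_elim
      case (elim j)
      then have "\<iota> j * (A $ i \<bullet> y j - (b $ i + A $ i \<bullet> d)) < 0"
        by (simp add: y_v algebra_simps)
      then have "A $ i \<bullet> y j < b $ i + A $ i \<bullet> d"
        using \<kappa>(2)[of j] by (simp add: mult_less_0_iff)
      then show ?case
        by (simp add: matrix_vector_mul_component inner_diff_right)
    qed
  qed
  then have "\<forall>\<^sub>F j in sequentially. \<forall>i. (A *v (y j - d) - b) $ i \<le> max ((A *v y j - b) $ i) 0"
    by (rule eventually_all_finite)
  \<comment> \<open>As \<open>d\<close> is a unit vector, the step shortens \<open>y j\<close>
    exactly when \<open>2 * (y j \<bullet> d) > 1\<close>; this holds eventually because
    \<open>v j \<bullet> d\<close> tends to 1.\<close>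
  moreover have "\<forall>\<^sub>F j in sequentially. norm (y j - d) < \<kappa> j"
  proof -
    have "(\<lambda>j. 2 * (v j \<bullet> d) - \<iota> j) \<longlonglongrightarrow> 2 * (d \<bullet> d) - 0"
      by (intro tendsto_intros v \<iota>)
    moreover have dd: "d \<bullet> d = 1"
      using d by (simp add: dot_square_norm)
    ultimately have "\<forall>\<^sub>F j in sequentially. 0 < 2 * (v j \<bullet> d) - \<iota> j"
      by (intro order_tendstoD(1)[where y = "2 * (d \<bullet> d) - 0"]) auto
    then show ?thesis
    proof eventually_elim
      case (elim j)
      then have "0 < \<kappa> j * (2 * (v j \<bullet> d) - \<iota> j)"
        using \<kappa>(1)[of j] by simp
      also have "\<kappa> j * (2 * (v j \<bullet> d) - \<iota> j) = 2 * (\<iota> j * \<kappa> j) * (y j \<bullet> d) - \<iota> j * \<kappa> j"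
        by (simp add: y_v algebra_simps)
      also have "\<dots> = 2 * (y j \<bullet> d) - d \<bullet> d"
        by (simp add: \<kappa>(3) dd)
      finally have "(norm (y j - d))\<^sup>2 < (norm (y j))\<^sup>2"
        by (simp add: power2_norm_eq_inner inner_diff_left inner_diff_right inner_commute)
      then show ?case
        using power_less_imp_less_base[of "norm (y j - d)" 2 "norm (y j)"]
        by (simp add: y_def norm_Y \<kappa>_def)
    qed
  qed
  ultimately have "\<forall>\<^sub>F j in sequentially. (\<forall>i. (A *v (y j - d) - b) $ i \<le> max ((A *v y j - b) $ i) 0)
      \<and> norm (y j - d) < \<kappa> j"
    by (rule eventually_conj)
  then obtain j where j: "\<And>i. (A *v (y j - d) - b) $ i \<le> max ((A *v y j - b) $ i) 0" "norm (y j - d) < \<kappa> j"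
    by (auto simp: eventually_sequentially)
  have "(Q *v y j) \<bullet> d = y j \<bullet> (Q *v d)"
    using symmetric by (metis dot_lmul_matrix vector_transpose_matrix)
  then have "quad_obj Q p (y j - d) = quad_obj Q p (y j)"
    using quad_obj_along[OF symmetric psd, of p "y j" "-1" d] by (simp add: Qd pd inner_add_left)
  then have "h (y j - d) \<le> h (y j)"
    using violation_mono[OF j(1)] by (simp add: h_def reduced_residual_def)
  moreover have "h (y j) \<le> h x" if "norm x \<le> \<kappa> j" for x
    using that Y(2) unfolding y_def \<kappa>_def by blast
  ultimately show False
    using no_interior[of "y j - d" "\<kappa> j"] j(2) by force
qed

section \<open>Points of least constraint violation\<close>

text \<open>With \<open>Q = 0\<close>, \<open>p = 0\<close> and \<open>t = 0\<close> the reduced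
  residual is a quarter of the squared violation, and the no-descent condition is trivial.\<close>

lemma violation_attained:
  fixes A :: "real^'n^'m"
  shows "\<exists>z. \<forall>x. (norm (pos_part (A *v z - b)))\<^sup>2 \<le> (norm (pos_part (A *v x - b)))\<^sup>2"
proof -
  have "\<exists>z. \<forall>x. reduced_residual 0 0 A b z 0 \<le> reduced_residual 0 0 A b x 0"
  proof (rule reduced_residual_attained_no_descent)
    show "transpose 0 = (0 :: real^'n^'n)"
      by (simp add: transpose_def zero_vec_def)
  qed simp_all
  then show ?thesis
    by (simp add: reduced_residual_def quad_obj_def)
qed

lemma norm_power2_along:
  fixes a w :: "'a::real_inner"
  shows "(norm (a + r *\<^sub>R w))\<^sup>2 = (norm a)\<^sup>2 + 2 * (a \<bullet> w) * r + (w \<bullet> w) * r\<^sup>2"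
proof -
  have "w \<bullet> a = a \<bullet> w"
    by (rule inner_commute)
  then have "(a + r *\<^sub>R w) \<bullet> (a + r *\<^sub>R w) = a \<bullet> a + 2 * (a \<bullet> w) * r + (w \<bullet> w) * (r * r)"
    by (simp add: inner_add_left inner_add_right algebra_simps)
  then show ?thesis
    unfolding power2_norm_eq_inner by (simp only: power2_eq_square)
qed

text \<open>The least violation is the projection of the origin onto the convex set of vectors
  dominating some \<open>pos_part (A *v x - b)\<close>. Its inner product with the difference
  \<open>w\<close> is thus nonnegative, and expanding the norm gives the bound.\<close>

lemma violation_projection:
  fixes A :: "real^'n^'m"
  assumes min: "\<And>x. (norm (pos_part (A *v z - b)))\<^sup>2 \<le> (norm (pos_part (A *v x - b)))\<^sup>2"
  shows "(norm (pos_part (A *v x - b) - pos_part (A *v z - b)))\<^sup>2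
    \<le> (norm (pos_part (A *v x - b)))\<^sup>2 - (norm (pos_part (A *v z - b)))\<^sup>2"
proof -
  define V where "V x = pos_part (A *v x - b)" for x
  define w where "w = V x - V z"
  have "0 \<le> 2 * (V z \<bullet> w)"
  proof (rule linear_coeff_nonneg)
    have "\<forall>\<^sub>F r::real in at_right 0. 0 < r \<and> r < 1"
      using eventually_at_right_real[of 0 1] by (auto elim: eventually_mono)
    then show "\<forall>\<^sub>F r in at_right 0. 0 \<le> 2 * (V z \<bullet> w) * r + (w \<bullet> w) * r\<^sup>2"
    proof eventually_elim
      case (elim r)
      define m where "m = (1 - r) *\<^sub>R z + r *\<^sub>R x"
      \<comment> \<open>The violation is only convex along the segment, but being dominated by the
        chord is enough to compare norms.\<close>
      have "(V m $ i)\<^sup>2 \<le> ((V z + r *\<^sub>R w) $ i)\<^sup>2" for i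
      proof (rule power_mono)
        have "(A *v m - b) $ i = (1 - r) * (A *v z - b) $ i + r * (A *v x - b) $ i"
          by (simp add: m_def matrix_vector_right_distrib matrix_vector_mult_scaleR algebra_simps)
        also have "\<dots> \<le> (1 - r) * V z $ i + r * V x $ i"
          using elim by (intro add_mono mult_left_mono) (auto simp: V_def)
        finally have "(A *v m - b) $ i \<le> (V z + r *\<^sub>R w) $ i"
          by (simp add: w_def algebra_simps)
        moreover have "0 \<le> (1 - r) * V z $ i + r * V x $ i"
          using elim by (intro add_nonneg_nonneg mult_nonneg_nonneg) (auto simp: V_def)
        then have "0 \<le> (V z + r *\<^sub>R w) $ i"
          by (simp add: w_def algebra_simps)
        ultimately show "V m $ i \<le> (V z + r *\<^sub>R w) $ i"
          by (simp add: V_def)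
      qed (simp add: V_def)
      then have "(norm (V m))\<^sup>2 \<le> (norm (V z + r *\<^sub>R w))\<^sup>2"
        unfolding norm_vec_power2 by (rule sum_mono)
      moreover have "(norm (V z))\<^sup>2 \<le> (norm (V m))\<^sup>2"
        unfolding V_def by (rule min)
      moreover have "(norm (V z + r *\<^sub>R w))\<^sup>2 = (norm (V z))\<^sup>2 + 2 * (V z \<bullet> w) * r + (w \<bullet> w) * r\<^sup>2"
        by (rule norm_power2_along)
      ultimately show ?case
        by linarith
    qed
  qed
  moreover have "(norm (V x))\<^sup>2 = (norm (V z))\<^sup>2 + 2 * (V z \<bullet> w) + (norm w)\<^sup>2"
    using norm_power2_along[of "V z" 1 w] by (simp add: w_def dot_square_norm)
  ultimately have "(norm w)\<^sup>2 \<le> (norm (V x))\<^sup>2 - (norm (V z))\<^sup>2"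
    by linarith
  then show ?thesis
    by (simp add: w_def V_def)
qed

section \<open>Attainment in general and the multiplier of the program\<close>

context
  fixes Q :: "real^'n^'n" and p :: "real^'n"
  assumes symmetric: "transpose Q = Q"
    and psd: "\<forall>x. x \<bullet> (Q *v x) \<ge> 0"
begin

text \<open>If a direction lowers \<open>q\<close> at a constant rate and raises no constraint,
  follow it from a point of least violation until \<open>q\<close> is at most \<open>t\<close>: the
  residual is then down to its violation part, which is least. Otherwise the no-descent lemma
  applies.\<close>

lemma reduced_residual_attained:
  fixes A :: "real^'n^'m"
  shows "\<exists>z. \<forall>x. reduced_residual Q p A b z t \<le> reduced_residual Q p A b x t"
proof (cases "\<exists>d. Q *v d = 0 \<and> p \<bullet> d < 0 \<and> (\<forall>i. A $ i \<bullet> d \<le> 0)")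
  case True
  then obtain d where d: "Q *v d = 0" "p \<bullet> d < 0" "\<And>i. A $ i \<bullet> d \<le> 0"
    by blast
  obtain z where z: "\<And>x. (norm (pos_part (A *v z - b)))\<^sup>2 \<le> (norm (pos_part (A *v x - b)))\<^sup>2"
    using violation_attained by blast
  define r where "r = max 0 ((quad_obj Q p z - t) / (- (p \<bullet> d)))"
  have "(Q *v z) \<bullet> d = z \<bullet> (Q *v d)"
    using symmetric by (metis dot_lmul_matrix vector_transpose_matrix)
  then have "quad_obj Q p (z + r *\<^sub>R d) = quad_obj Q p z - r * (- (p \<bullet> d))"
    using quad_obj_along[OF symmetric psd, of p z r d] by (simp add: d inner_add_left)
  moreover have "(quad_obj Q p z - t) / (- (p \<bullet> d)) \<le> r"
    by (simp add: r_def)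
  then have "quad_obj Q p z - t \<le> r * (- (p \<bullet> d))"
    using d(2) by (subst (asm) pos_divide_le_eq) auto
  ultimately have "quad_obj Q p (z + r *\<^sub>R d) - t \<le> 0"
    by simp
  moreover have "(norm (pos_part (A *v (z + r *\<^sub>R d) - b)))\<^sup>2 \<le> (norm (pos_part (A *v z - b)))\<^sup>2"
  proof (rule violation_mono)
    fix i
    have "r * (A $ i \<bullet> d) \<le> 0"
      using d(3) by (simp add: r_def mult_nonneg_nonpos)
    then show "(A *v (z + r *\<^sub>R d) - b) $ i \<le> max ((A *v z - b) $ i) 0"
      by (simp add: matrix_vector_mul_component inner_add_right)
  qed
  ultimately have "reduced_residual Q p A b (z + r *\<^sub>R d) t \<le> 1 / 4 * (norm (pos_part (A *v x - b)))\<^sup>2" for x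
    using z[of x] by (simp add: reduced_residual_def max_absorb2)
  moreover have "1 / 4 * (norm (pos_part (A *v x - b)))\<^sup>2 \<le> reduced_residual Q p A b x t" for x
    by (simp add: reduced_residual_def)
  ultimately show ?thesis
    using order_trans by blast
next
  case False
  then show ?thesis
    by (intro reduced_residual_attained_no_descent[OF symmetric psd]) force
qed

text \<open>Optimality excludes first-order descent along the active constraints, so by separation
  (Farkas) the negative gradient lies in the cone of the active rows. Its coefficients form the
  multiplier, and the tangent inequality for \<open>q\<close> makes the bound global.\<close>

lemma quadratic_program_multiplier:
  fixes A :: "real^'n^'m"
  assumes feasible: "\<And>i. (A *v z) $ i \<le> c $ i"
    and optimal: "\<And>x. (\<And>i. (A *v x) $ i \<le> c $ i) \<Longrightarrow> quad_obj Q p z \<le> quad_obj Q p x"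
  obtains y where "\<And>i. 0 \<le> y $ i" "\<And>x. quad_obj Q p z \<le> quad_obj Q p x + y \<bullet> (A *v x - c)"
proof -
  define g I where "g = Q *v z + p" and "I = {i. (A *v z) $ i = c $ i}"
  have descent: "0 \<le> g \<bullet> d" if d: "\<And>i. i \<in> I \<Longrightarrow> A $ i \<bullet> d \<le> 0" for d
  proof (rule linear_coeff_nonneg)
    \<comment> \<open>Small steps stay feasible: active constraints do not increase, and inactive
      ones hold strictly at \<open>z\<close>.\<close>
    have "\<forall>\<^sub>F r in at_right 0. (A *v (z + r *\<^sub>R d)) $ i \<le> c $ i" for i
    proof (cases "i \<in> I")
      case True
      have "\<forall>\<^sub>F r::real in at_right 0. 0 < r"
        by (rule eventually_at_right_less)
      then show ?thesis
      proof eventually_elim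
        case (elim r)
        then have "r * (A $ i \<bullet> d) \<le> 0"
          using d[OF True] by (simp add: mult_nonneg_nonpos)
        then show ?case
          using feasible[of i] by (simp add: matrix_vector_mul_component inner_add_right)
      qed
    next
      case False
      have "((\<lambda>r. A $ i \<bullet> z + r * (A $ i \<bullet> d)) \<longlongrightarrow> A $ i \<bullet> z + 0 * (A $ i \<bullet> d)) (at_right 0)"
        by (intro tendsto_intros)
      moreover have "A $ i \<bullet> z + 0 * (A $ i \<bullet> d) < c $ i"
        using False feasible[of i] by (simp add: I_def matrix_vector_mul_component)
      ultimately have "\<forall>\<^sub>F r in at_right 0. A $ i \<bullet> z + r * (A $ i \<bullet> d) < c $ i"
        by (rule order_tendstoD)
      then show ?thesis
        by eventually_elim (simp add: matrix_vector_mul_component inner_add_right)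
    qed
    then have "\<forall>\<^sub>F r in at_right 0. \<forall>i. (A *v (z + r *\<^sub>R d)) $ i \<le> c $ i"
      by (rule eventually_all_finite)
    then show "\<forall>\<^sub>F r in at_right 0. 0 \<le> (g \<bullet> d) * r + (d \<bullet> (Q *v d) / 2) * r\<^sup>2"
    proof eventually_elim
      case (elim r)
      then have "quad_obj Q p z \<le> quad_obj Q p (z + r *\<^sub>R d)"
        using optimal by blast
      then show ?case
        using quad_obj_along[OF symmetric psd, of p z r d] by (simp add: g_def algebra_simps)
    qed
  qed
  define H where "H = convex_cone hull ((\<lambda>i. A $ i) ` I)"
  have "- g \<in> H"
  proof (rule ccontr)
    assume "- g \<notin> H"
    moreover have "closed H"
      unfolding H_def by (simp add: closed_convex_cone_hull)
    moreover have "convex H"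
      unfolding H_def by (rule convex_convex_cone_hull)
    ultimately obtain a \<beta> where sep: "a \<bullet> (- g) < \<beta>" "\<And>x. x \<in> H \<Longrightarrow> \<beta> < a \<bullet> x"
      using separating_hyperplane_closed_point by metis
    have "0 \<in> H"
      unfolding H_def by (rule convex_cone_hull_contains_0)
    then have "\<beta> < 0"
      using sep(2)[of 0] by simp
    have "A $ i \<bullet> (- a) \<le> 0" if "i \<in> I" for i
    proof (rule ccontr)
      assume "\<not> ?thesis"
      then have neg: "a \<bullet> A $ i < 0"
        by (simp add: inner_commute)
      \<comment> \<open>This nonnegative multiple of the row has inner product exactly
        \<open>\<beta>\<close> with \<open>a\<close>, against the strict separation.\<close>
      have "(\<beta> / (a \<bullet> A $ i)) *\<^sub>R A $ i \<in> H"
        unfolding H_def using that neg \<open>\<beta> < 0\<close>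
        by (intro convex_cone_hull_mul hull_inc) (auto simp: divide_nonpos_neg)
      then show False
        using sep(2) neg by fastforce
    qed
    then have "0 \<le> g \<bullet> (- a)"
      by (rule descent)
    then show False
      using sep(1) \<open>\<beta> < 0\<close> by (simp add: inner_commute)
  qed
  \<comment> \<open>The functionals given by nonnegative weights supported on the active rows form a
    convex cone containing those rows, hence the whole hull.\<close>
  moreover have "H \<subseteq> {v. \<exists>y. (\<forall>i. 0 \<le> y $ i \<and> (i \<notin> I \<longrightarrow> y $ i = 0)) \<and> (\<forall>x. v \<bullet> x = y \<bullet> (A *v x))}"
    (is "_ \<subseteq> ?C")
    unfolding H_def
  proof (rule hull_minimal)
    show "(\<lambda>i. A $ i) ` I \<subseteq> ?C"
    proof clarify
      fix i assume "i \<in> I"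
      moreover have "axis i (1 :: real) $ j = (if j = i then 1 else 0)" for j
        by (simp add: axis_def)
      ultimately show "\<exists>y. (\<forall>j. 0 \<le> y $ j \<and> (j \<notin> I \<longrightarrow> y $ j = 0)) \<and> (\<forall>x. A $ i \<bullet> x = y \<bullet> (A *v x))"
        by (intro exI[of _ "axis i 1"]) (auto simp: inner_axis' matrix_vector_mul_component)
    qed
    have "0 \<in> ?C"
      by (auto intro!: exI[of _ 0])
    moreover have "u + w \<in> ?C" if "u \<in> ?C" "w \<in> ?C" for u w
    proof -
      from that obtain y y' where "\<forall>i. 0 \<le> y $ i \<and> (i \<notin> I \<longrightarrow> y $ i = 0)" "\<forall>x. u \<bullet> x = y \<bullet> (A *v x)"
        "\<forall>i. 0 \<le> y' $ i \<and> (i \<notin> I \<longrightarrow> y' $ i = 0)" "\<forall>x. w \<bullet> x = y' \<bullet> (A *v x)"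
        by blast
      then show ?thesis
        by (intro CollectI exI[of _ "y + y'"]) (simp add: inner_add_left)
    qed
    moreover have "a *\<^sub>R u \<in> ?C" if "u \<in> ?C" "0 \<le> a" for u a
    proof -
      from that obtain y where "\<forall>i. 0 \<le> y $ i \<and> (i \<notin> I \<longrightarrow> y $ i = 0)" "\<forall>x. u \<bullet> x = y \<bullet> (A *v x)"
        by blast
      then show ?thesis
        using \<open>0 \<le> a\<close> by (intro CollectI exI[of _ "a *\<^sub>R y"]) simp
    qed
    ultimately show "convex_cone ?C"
      unfolding convex_cone_iff by blast
  qed
  ultimately obtain y where y: "\<And>i. 0 \<le> y $ i" "\<And>i. i \<notin> I \<Longrightarrow> y $ i = 0" "\<And>x. - g \<bullet> x = y \<bullet> (A *v x)"
    by blast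
  \<comment> \<open>Complementary slackness.\<close>
  have "y $ i * (A *v z) $ i = y $ i * c $ i" for i
    using y(2)[of i] by (cases "i \<in> I") (auto simp: I_def)
  then have "y \<bullet> (A *v z) = y \<bullet> c"
    unfolding inner_vec_def inner_real_def by (simp only:)
  then have "quad_obj Q p z \<le> quad_obj Q p x + y \<bullet> (A *v x - c)" for x
    using quad_obj_ge_tangent[OF symmetric psd, of p z x] y(3)[of x] y(3)[of z]
    unfolding g_def[symmetric] by (simp add: inner_diff_right)
  with y(1) show ?thesis
    using that by blast
qed

end

section \<open>The value function\<close>

lemma zero_subgradient_iff: "0 \<in> subdifferential f t \<longleftrightarrow> (\<forall>s. f t \<le> f s)"
  by (simp add: subdifferential_def)

lemma residual_nonneg: "0 \<le> residual Q p A b x s t"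
  by (simp add: residual_def)

lemma residual_value_le: "residual_value Q p A b t \<le> reduced_residual Q p A b x t"
proof -
  have "bdd_below (range (\<lambda>(x, s). residual Q p A b x s t))"
    by (rule bdd_belowI[of _ 0]) (auto simp: residual_nonneg)
  then have "residual_value Q p A b t \<le> residual Q p A b x (best_slack (A *v x - b)) t"
    unfolding residual_value_def by (rule cINF_lower2[where x = "(x, best_slack (A *v x - b))"]) auto
  then show ?thesis
    by (simp add: residual_best_slack)
qed

context
  fixes Q :: "real^'n^'n" and p :: "real^'n" and A :: "real^'n^'m" and b :: "real^'m"
  assumes symmetric: "transpose Q = Q"
    and psd: "\<forall>x. x \<bullet> (Q *v x) \<ge> 0"
begin

lemma residual_attained: "\<exists>xs. is_arg_min (\<lambda>(x, s). residual Q p A b x s t) (\<lambda>_. True) xs"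
proof -
  obtain z where z: "\<And>x. reduced_residual Q p A b z t \<le> reduced_residual Q p A b x t"
    using reduced_residual_attained[OF symmetric psd] by blast
  have "residual Q p A b z (best_slack (A *v z - b)) t \<le> residual Q p A b x s t" for x s
    using z[of x] residual_ge_reduced[of Q p A b x t s] by (simp add: residual_best_slack)
  then show ?thesis
    by (intro exI[of _ "(z, best_slack (A *v z - b))"]) (auto simp: is_arg_min_linorder)
qed

lemma residual_value_attained: "\<exists>z. residual_value Q p A b t = reduced_residual Q p A b z t"
proof -
  obtain z where z: "\<And>x. reduced_residual Q p A b z t \<le> reduced_residual Q p A b x t"
    using reduced_residual_attained[OF symmetric psd] by blast
  have "reduced_residual Q p A b z t \<le> residual_value Q p A b t"
    unfolding residual_value_def
    by (rule cINF_greatest) (auto intro: order_trans[OF z residual_ge_reduced])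
  then show ?thesis
    using residual_value_le antisym by blast
qed

lemma antimono_residual_value: "antimono (residual_value Q p A b)"
proof (rule antimonoI)
  fix t t' :: real assume "t \<le> t'"
  obtain z where z: "residual_value Q p A b t = reduced_residual Q p A b z t"
    using residual_value_attained by blast
  have "(max (quad_obj Q p z - t') 0)\<^sup>2 \<le> (max (quad_obj Q p z - t) 0)\<^sup>2"
    using \<open>t \<le> t'\<close> by (intro power_mono) auto
  then show "residual_value Q p A b t' \<le> residual_value Q p A b t"
    using residual_value_le[of Q p A b t' z] z
    unfolding reduced_residual_def by linarith
qed

text \<open>Partial minimisation of a jointly convex function: the combination of the two minimisers
  is a candidate in between.\<close>

lemma convex_residual_value: "convex_on UNIV (residual_value Q p A b)"
proof (rule convex_onI)
  fix r t t' :: real assume r: "0 < r" "r < 1"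
  obtain z z' where z: "residual_value Q p A b t = reduced_residual Q p A b z t"
    "residual_value Q p A b t' = reduced_residual Q p A b z' t'"
    using residual_value_attained by metis
  show "residual_value Q p A b ((1 - r) *\<^sub>R t + r *\<^sub>R t')
      \<le> (1 - r) * residual_value Q p A b t + r * residual_value Q p A b t'"
    using order_trans[OF residual_value_le reduced_residual_convex[OF symmetric psd, of r p A b z z' t t']] r
    by (simp add: z)
qed simp

text \<open>The violation part alone bounds the value below for every \<open>t\<close>, and at
  \<open>t = quad_obj Q p z\<close> the objective part vanishes.\<close>

lemma residual_value_minimum:
  assumes z: "\<And>x. (norm (pos_part (A *v z - b)))\<^sup>2 \<le> (norm (pos_part (A *v x - b)))\<^sup>2"
  shows "1 / 4 * (norm (pos_part (A *v z - b)))\<^sup>2 \<le> residual_value Q p A b t"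
    and "residual_value Q p A b (quad_obj Q p z) = 1 / 4 * (norm (pos_part (A *v z - b)))\<^sup>2"
proof -
  have lower: "1 / 4 * (norm (pos_part (A *v z - b)))\<^sup>2 \<le> residual_value Q p A b t" for t
  proof -
    obtain x where "residual_value Q p A b t = reduced_residual Q p A b x t"
      using residual_value_attained by blast
    then show ?thesis
      using z[of x] zero_le_power2[of "max (quad_obj Q p x - t) 0"]
      unfolding reduced_residual_def by linarith
  qed
  show "1 / 4 * (norm (pos_part (A *v z - b)))\<^sup>2 \<le> residual_value Q p A b t"
    by (rule lower)
  have "residual_value Q p A b (quad_obj Q p z) \<le> 1 / 4 * (norm (pos_part (A *v z - b)))\<^sup>2"
    using residual_value_le[of Q p A b "quad_obj Q p z" z] by (simp add: reduced_residual_def)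
  then show "residual_value Q p A b (quad_obj Q p z) = 1 / 4 * (norm (pos_part (A *v z - b)))\<^sup>2"
    using lower by (rule antisym)
qed

section \<open>Minimisers of the value function, quadratic growth and calmness\<close>

lemma residual_value_minimiser_exists: "\<exists>t. \<forall>s. residual_value Q p A b t \<le> residual_value Q p A b s"
proof -
  obtain z where "\<And>x. (norm (pos_part (A *v z - b)))\<^sup>2 \<le> (norm (pos_part (A *v x - b)))\<^sup>2"
    using violation_attained by blast
  from residual_value_minimum[OF this] show ?thesis
    by metis
qed

text \<open>The points of least violation are those with \<open>A x \<le> b + v\<close>, where \<open>v\<close> is the least violation, so
  an infeasible program behaves like the feasible one with \<open>b + v\<close> in place of \<open>b\<close>; a Lagrange
  multiplier of that program bounds the loss in \<open>q\<close> by the excess violation.\<close>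

lemma residual_value_growth:
  assumes min: "\<And>s. residual_value Q p A b ts \<le> residual_value Q p A b s"
    and least: "\<And>t. (\<And>s. residual_value Q p A b t \<le> residual_value Q p A b s) \<Longrightarrow> ts \<le> t"
  obtains c where "c > 0"
    "\<And>t. t \<le> ts \<Longrightarrow> residual_value Q p A b ts + c * (ts - t)\<^sup>2 \<le> residual_value Q p A b t"
proof -
  define \<rho> where "\<rho> = residual_value Q p A b"
  obtain w where w: "\<And>x. (norm (pos_part (A *v w - b)))\<^sup>2 \<le> (norm (pos_part (A *v x - b)))\<^sup>2"
    using violation_attained by blast
  obtain z where z: "\<rho> ts = reduced_residual Q p A b z ts"
    using residual_value_attained unfolding \<rho>_def by blast
  have ts_w: "\<rho> ts = 1 / 4 * (norm (pos_part (A *v w - b)))\<^sup>2"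
    using residual_value_minimum[OF w] min[of "quad_obj Q p w"] unfolding \<rho>_def by (metis antisym)
  \<comment> \<open>The value at \<open>ts\<close> is the least violation alone, so neither part of
    the residual at \<open>z\<close> has room above its lower bound.\<close>
  have "(max (quad_obj Q p z - ts) 0)\<^sup>2 \<le> 0" and zw: "(norm (pos_part (A *v z - b)))\<^sup>2 \<le> (norm (pos_part (A *v w - b)))\<^sup>2"
    using w[of z] z ts_w zero_le_power2[of "max (quad_obj Q p z - ts) 0"]
    unfolding reduced_residual_def by linarith+
  then have qz: "quad_obj Q p z \<le> ts"
    by simp
  have z_min: "(norm (pos_part (A *v z - b)))\<^sup>2 \<le> (norm (pos_part (A *v x - b)))\<^sup>2" for x
    using zw w order_trans by blast
  define v where "v = pos_part (A *v z - b)"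
  have feasible: "(A *v z) $ i \<le> (b + v) $ i" for i
    by (simp add: v_def max_def)
  \<comment> \<open>A point of the relaxed program also has least violation, so its objective value
    minimises the value function and cannot lie below the least minimiser \<open>ts\<close>.\<close>
  have optimal: "ts \<le> quad_obj Q p x" if "\<And>i. (A *v x) $ i \<le> (b + v) $ i" for x
  proof (rule least)
    have "(norm (pos_part (A *v x - b)))\<^sup>2 \<le> (norm (pos_part (A *v z - b)))\<^sup>2"
    proof (rule violation_mono)
      fix i show "(A *v x - b) $ i \<le> max ((A *v z - b) $ i) 0"
        using that[of i] by (simp add: v_def)
    qed
    then have "\<And>x'. (norm (pos_part (A *v x - b)))\<^sup>2 \<le> (norm (pos_part (A *v x' - b)))\<^sup>2"
      using z_min order_trans by blast
    note least_value = residual_value_minimum[OF this]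
    show "residual_value Q p A b (quad_obj Q p x) \<le> residual_value Q p A b s" for s
      unfolding least_value(2) by (rule least_value(1))
  qed
  have z_ts: "quad_obj Q p z = ts"
    using qz optimal[of z] feasible by (simp add: antisym)
  obtain y where y: "\<And>i. 0 \<le> y $ i" "\<And>x. quad_obj Q p z \<le> quad_obj Q p x + y \<bullet> (A *v x - (b + v))"
    using quadratic_program_multiplier[OF symmetric psd, of A z "b + v" p] feasible optimal z_ts by blast
  \<comment> \<open>The added 1 ensures \<open>Y \<ge> 1\<close>, so that \<open>Y\<^sup>2\<close>
    may also be put in front of \<open>a\<^sup>2\<close>.\<close>
  define Y where "Y = norm y + 1"
  have "Y \<ge> 1"
    by (simp add: Y_def)
  have "\<rho> ts + 1 / (8 * Y\<^sup>2) * (ts - t)\<^sup>2 \<le> \<rho> t" if "t \<le> ts" for t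
  proof -
    obtain x where x: "\<rho> t = reduced_residual Q p A b x t"
      using residual_value_attained unfolding \<rho>_def by blast
    define e a where "e = norm (pos_part (A *v x - b) - v)" and "a = max (quad_obj Q p x - t) 0"
    have "y \<bullet> (A *v x - (b + v)) \<le> y \<bullet> (pos_part (A *v x - b) - v)"
      unfolding inner_vec_def inner_real_def
      by (intro sum_mono mult_left_mono y) simp
    also have "\<dots> \<le> norm y * e"
      unfolding e_def by (rule norm_cauchy_schwarz)
    also have "\<dots> \<le> Y * e"
      by (simp add: Y_def e_def mult_right_mono)
    finally have "ts - t \<le> a + Y * e"
      using y(2)[of x] z_ts by (simp add: a_def)
    then have "(ts - t)\<^sup>2 \<le> (a + Y * e)\<^sup>2"
      using that by (intro power_mono) auto
    also have "\<dots> \<le> 2 * a\<^sup>2 + 2 * (Y * e)\<^sup>2"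
      using zero_le_power2[of "a - Y * e"] by (simp add: power2_eq_square algebra_simps)
    \<comment> \<open>The factor 8 turns \<open>1 / 4 * e\<^sup>2\<close> into exactly
      \<open>2 * (Y * e)\<^sup>2\<close> and is more than enough for
      \<open>a\<^sup>2\<close>.\<close>
    also have "\<dots> \<le> 8 * Y\<^sup>2 * (1 / 2 * a\<^sup>2 + 1 / 4 * e\<^sup>2)"
    proof -
      have "1 * a\<^sup>2 \<le> Y\<^sup>2 * a\<^sup>2"
        using \<open>Y \<ge> 1\<close> by (intro mult_right_mono) auto
      moreover have "8 * Y\<^sup>2 * (1 / 2 * a\<^sup>2 + 1 / 4 * e\<^sup>2) = 4 * (Y\<^sup>2 * a\<^sup>2) + 2 * (Y * e)\<^sup>2"
        by (simp add: power_mult_distrib algebra_simps)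
      ultimately show ?thesis
        using zero_le_power2[of a] by linarith
    qed
    finally have "1 / (8 * Y\<^sup>2) * (ts - t)\<^sup>2 \<le> 1 / 2 * a\<^sup>2 + 1 / 4 * e\<^sup>2"
      using \<open>Y \<ge> 1\<close> by (simp add: pos_divide_le_eq mult.commute)
    \<comment> \<open>The multiplier controls a distance of violations, while the value function
      sees a difference of squared norms; the projection inequality links the two.\<close>
    moreover have "e\<^sup>2 \<le> (norm (pos_part (A *v x - b)))\<^sup>2 - (norm v)\<^sup>2"
      using violation_projection[OF z_min] unfolding e_def v_def .
    moreover have "\<rho> ts = 1 / 4 * (norm v)\<^sup>2"
      using z z_ts by (simp add: reduced_residual_def v_def)
    moreover have "\<rho> t = 1 / 2 * a\<^sup>2 + 1 / 4 * (norm (pos_part (A *v x - b)))\<^sup>2"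
      by (simp add: x reduced_residual_def a_def)
    ultimately show ?thesis
      by linarith
  qed
  moreover have "1 / (8 * Y\<^sup>2) > 0"
    using \<open>Y \<ge> 1\<close> by simp
  ultimately show ?thesis
    using that unfolding \<rho>_def by blast
qed

text \<open>For \<open>t < ts\<close> the subgradient inequality tested at \<open>ts\<close>,
  combined with growth, gives \<open>c * (ts - t) \<le> norm w\<close>. So \<open>1 / c\<close> is a
  calmness constant, and the threshold on \<open>w\<close> is arbitrary.\<close>

lemma calmness_residual_value: "calmness_criterion (subdifferential (residual_value Q p A b))"
proof -
  define \<rho> S where "\<rho> = residual_value Q p A b" and "S = {t. 0 \<in> subdifferential \<rho> t}"
  have S_iff: "t \<in> S \<longleftrightarrow> (\<forall>s. \<rho> t \<le> \<rho> s)" for t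
    by (simp add: S_def zero_subgradient_iff)
  have "S \<noteq> {}"
    using residual_value_minimiser_exists S_iff unfolding \<rho>_def by blast
  have upward: "t' \<in> S" if "t \<in> S" "t \<le> t'" for t t'
    using that antimonoD[OF antimono_residual_value, of t t'] order_trans
    unfolding S_iff \<rho>_def by blast
  have "\<exists>\<phi>>0. \<forall>t. \<forall>w\<in>subdifferential \<rho> t. norm (t - closest_point S t) \<le> \<phi> * norm w"
  \<comment> \<open>\<open>S\<close> is closed upwards, so it either has a least element or is the
    whole line; in the latter case all distances vanish.\<close>
  proof (cases "S = UNIV")
    case True
    then show ?thesis
      by (intro exI[of _ 1]) (simp add: closest_point_self)
  next
    case False
    then obtain l where l: "l \<notin> S"
      by blast
    have bdd: "bdd_below S"
      using upward l by (intro bdd_belowI[of _ l]) (meson linear)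
    have "continuous_on UNIV \<rho>"
      using convex_on_continuous[OF open_UNIV convex_residual_value] by (simp add: \<rho>_def)
    moreover have "S = (\<Inter>s. {t. \<rho> t \<le> \<rho> s})"
      using S_iff by blast
    ultimately have "closed S"
      by (auto intro!: closed_INT closed_Collect_le continuous_intros)
    define ts where "ts = Inf S"
    have ts: "ts \<in> S"
      unfolding ts_def by (rule closed_contains_Inf[OF \<open>S \<noteq> {}\<close> bdd \<open>closed S\<close>])
    have least: "ts \<le> t" if "t \<in> S" for t
      unfolding ts_def using that bdd by (rule cInf_lower)
    obtain c where c: "c > 0" "\<And>t. t \<le> ts \<Longrightarrow> \<rho> ts + c * (ts - t)\<^sup>2 \<le> \<rho> t"
      using residual_value_growth[of ts] ts least unfolding S_iff \<rho>_def by blast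
    have "norm (t - closest_point S t) \<le> 1 / c * norm w" if w: "w \<in> subdifferential \<rho> t" for t w
    proof (cases "t \<in> S")
      case True
      then show ?thesis
        using c by (simp add: closest_point_self)
    next
      case False
      then have "t < ts"
        using upward[OF ts] not_le by blast
      have "\<rho> t + w * (ts - t) \<le> \<rho> ts"
        using w by (auto simp: subdifferential_def)
      then have "c * (ts - t)\<^sup>2 \<le> - w * (ts - t)"
        using c(2)[of t] \<open>t < ts\<close> by simp
      also have "\<dots> \<le> norm w * (ts - t)"
        using \<open>t < ts\<close> by (intro mult_right_mono) auto
      finally have "(c * (ts - t)) * (ts - t) \<le> norm w * (ts - t)"
        by (simp add: power2_eq_square algebra_simps)
      then have "(ts - t) * c \<le> norm w"
        using \<open>t < ts\<close> by (simp add: mult.commute)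
      then have "ts - t \<le> norm w / c"
        using c(1) by (simp add: pos_le_divide_eq)
      moreover have "norm (t - closest_point S t) \<le> ts - t"
        using closest_point_le[OF \<open>closed S\<close> ts, of t] \<open>t < ts\<close> by (simp add: dist_norm)
      ultimately show ?thesis
        by simp
    qed
    then show ?thesis
      using c(1) by (intro exI[of _ "1 / c"]) simp
  qed
  then show ?thesis
    using \<open>S \<noteq> {}\<close> zero_less_one unfolding calmness_criterion_def Let_def S_def \<rho>_def by blast
qed

section \<open>Convergence rates of the Proximal Value Method\<close>

text \<open>Monotone \<open>\<sigma>\<close> covers both regimes:
  \<open>1 / (1 + c * \<sigma> 0)\<close> bounds all contraction factors uniformly below 1.\<close>

lemma proximal_value_method_rate:
  assumes ts: "is_minimum {t. 0 \<in> subdifferential (residual_value Q p A b) t} ts"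
    and pvm: "proximal_value_method Q p A b \<sigma> \<epsilon> \<nu> \<alpha> \<beta> xh sh x s t"
    and "t 0 \<le> ts" and \<sigma>_mono: "incseq \<sigma>"
  obtains c \<tau> where "c > 0" "\<tau> \<in> {ts .. ts + (\<Sum>k. error_bound \<epsilon> \<nu> t k)}" "t \<longlonglongrightarrow> \<tau>" "\<epsilon> \<longlonglongrightarrow> 0"
    "\<forall>\<^sub>F k in sequentially.
      \<bar>t (Suc k) - \<tau>\<bar> \<le> (1 / (1 + c * \<sigma> k) + \<epsilon> k) / (1 - \<epsilon> k) * \<bar>t k - \<tau>\<bar>"
proof -
  have min: "residual_value Q p A b ts \<le> residual_value Q p A b s" for s
    using ts unfolding is_minimum_def by (simp add: zero_subgradient_iff)
  have least: "(\<And>s. residual_value Q p A b t \<le> residual_value Q p A b s) \<Longrightarrow> ts \<le> t" for t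
    using ts unfolding is_minimum_def by (simp add: zero_subgradient_iff)
  obtain c where c: "c > 0"
    "\<And>t. t \<le> ts \<Longrightarrow> residual_value Q p A b ts + c * (ts - t)\<^sup>2 \<le> residual_value Q p A b t"
    using residual_value_growth[OF min least] by blast
  have \<sigma>: "\<sigma> k > 0" and \<epsilon>: "\<epsilon> k \<ge> 0" "summable \<epsilon>" and "\<nu> \<ge> 1"
    and step: "\<bar>t (Suc k) - prox (\<sigma> k) (residual_value Q p A b) (t k)\<bar> \<le> error_bound \<epsilon> \<nu> t k" for k
    using pvm unfolding proximal_value_method_def by blast+
  note prox_facts = convex_residual_value antimono_residual_value min c(2)
  have pos: "1 + c * \<sigma> k > 0" for k
    using c(1) \<sigma>[of k] by (simp add: add_pos_pos)
  have "\<exists>\<tau>\<in>{ts .. ts + (\<Sum>k. error_bound \<epsilon> \<nu> t k)}. t \<longlonglongrightarrow> \<tau> \<and>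
    (\<forall>\<^sub>F k in sequentially.
      \<bar>t (Suc k) - \<tau>\<bar> \<le> (1 / (1 + c * \<sigma> k) + \<epsilon> k) / (1 - \<epsilon> k) * \<bar>t k - \<tau>\<bar>)"
  proof (rule inexact_contraction_converges[where P = "\<lambda>k. prox (\<sigma> k) (residual_value Q p A b)"
        and \<rho> = "\<lambda>k. 1 / (1 + c * \<sigma> k)" and r = "1 / (1 + c * \<sigma> 0)",
        OF \<epsilon> \<open>\<nu> \<ge> 1\<close> step _ _ _ _ _ _ \<open>t 0 \<le> ts\<close>])
    fix k u
    show "prox (\<sigma> k) (residual_value Q p A b) u = u" if "ts \<le> u"
      using prox_above_minimiser[OF prox_facts \<sigma> that] .
    show "prox (\<sigma> k) (residual_value Q p A b) u \<le> ts" if "u \<le> ts"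
      using prox_below_minimiser(1)[OF prox_facts \<sigma> that c(1)] .
    show "ts - prox (\<sigma> k) (residual_value Q p A b) u \<le> 1 / (1 + c * \<sigma> k) * (ts - u)" if "u \<le> ts"
      using prox_below_minimiser(2)[OF prox_facts \<sigma>[of k] that c(1)] pos[of k]
      by (simp add: pos_le_divide_eq mult.commute)
    show "0 \<le> 1 / (1 + c * \<sigma> k)"
      using pos[of k] by simp
    show "1 / (1 + c * \<sigma> k) \<le> 1 / (1 + c * \<sigma> 0)"
      using incseqD[OF \<sigma>_mono, of 0 k] c(1) pos[of 0] by (intro divide_left_mono) (auto simp: pos)
    show "1 / (1 + c * \<sigma> 0) < 1"
      using c(1) \<sigma>[of 0] pos[of 0] by (simp add: divide_less_eq)
  qed
  then show ?thesis
    using that c(1) summable_LIMSEQ_zero[OF \<epsilon>(2)] by blast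
qed

end

theorem theorem10:
  fixes Q :: "real^'n^'n" and p :: "real^'n" and A :: "real^'n^'m" and b :: "real^'m"
  assumes "transpose Q = Q"
    and "\<forall>x. x \<bullet> (Q *v x) \<ge> 0"
  shows "(\<forall>t. \<exists>xs. is_arg_min (\<lambda>(x, s). residual Q p A b x s t) (\<lambda>_. True) xs)
    \<and> calmness_criterion (subdifferential (residual_value Q p A b))
    \<and> (\<forall>t_star \<sigma> \<epsilon> \<nu> \<alpha> \<beta> xh sh x s t.
         is_minimum {t. 0 \<in> subdifferential (residual_value Q p A b) t} t_star \<longrightarrow>
         proximal_value_method Q p A b \<sigma> \<epsilon> \<nu> \<alpha> \<beta> xh sh x s t \<longrightarrow>
         t 0 \<le> t_star \<longrightarrow>
         (incseq \<sigma> \<and> filterlim \<sigma> at_top sequentially \<longrightarrow>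
            (\<exists>\<tau>\<in>{t_star .. t_star + (\<Sum>k. error_bound \<epsilon> \<nu> t k)}. converges_superlinearly t \<tau>)) \<and>
         ((\<exists>c. \<forall>k. \<sigma> k = c) \<longrightarrow>
            (\<exists>\<tau>\<in>{t_star .. t_star + (\<Sum>k. error_bound \<epsilon> \<nu> t k)}. converges_linearly t \<tau>)))"
proof (intro conjI allI impI)
  show "\<exists>xs. is_arg_min (\<lambda>(x, s). residual Q p A b x s t) (\<lambda>_. True) xs" for t
    by (rule residual_attained[OF assms])
  show "calmness_criterion (subdifferential (residual_value Q p A b))"
    by (rule calmness_residual_value[OF assms])
next
  fix ts \<sigma> \<epsilon> \<nu> \<alpha> \<beta> xh sh x s t
  assume hyps: "is_minimum {t. 0 \<in> subdifferential (residual_value Q p A b) t} ts"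
    "proximal_value_method Q p A b \<sigma> \<epsilon> \<nu> \<alpha> \<beta> xh sh x s t" "t 0 \<le> ts"
  {
    assume \<sigma>: "incseq \<sigma> \<and> filterlim \<sigma> at_top sequentially"
    obtain c \<tau> where c: "c > 0" "\<tau> \<in> {ts .. ts + (\<Sum>k. error_bound \<epsilon> \<nu> t k)}" "t \<longlonglongrightarrow> \<tau>" "\<epsilon> \<longlonglongrightarrow> 0"
      "\<forall>\<^sub>F k in sequentially.
        \<bar>t (Suc k) - \<tau>\<bar> \<le> (1 / (1 + c * \<sigma> k) + \<epsilon> k) / (1 - \<epsilon> k) * \<bar>t k - \<tau>\<bar>"
      using proximal_value_method_rate[OF assms hyps] \<sigma> by blast
    have "filterlim (\<lambda>k. 1 + c * \<sigma> k) at_top sequentially"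
      using c(1) \<sigma>
      by (intro filterlim_tendsto_add_at_top[OF tendsto_const]
          filterlim_tendsto_pos_mult_at_top[OF tendsto_const]) auto
    then have "(\<lambda>k. 1 / (1 + c * \<sigma> k)) \<longlonglongrightarrow> 0"
      by (intro tendsto_divide_0[OF tendsto_const]) (rule filterlim_at_top_imp_at_infinity)
    then have "(\<lambda>k. (1 / (1 + c * \<sigma> k) + \<epsilon> k) / (1 - \<epsilon> k)) \<longlonglongrightarrow> (0 + 0) / (1 - 0)"
      using c(4) by (intro tendsto_intros) auto
    then have "converges_superlinearly t \<tau>"
      unfolding converges_superlinearly_def using c(3,5) by auto
    with c(2) show "\<exists>\<tau>\<in>{ts .. ts + (\<Sum>k. error_bound \<epsilon> \<nu> t k)}. converges_superlinearly t \<tau>"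
      by blast
  next
    assume "\<exists>c. \<forall>k. \<sigma> k = c"
    then have \<sigma>: "\<sigma> k = \<sigma> 0" for k
      by metis
    have "incseq \<sigma>"
      using \<sigma> by (intro incseq_SucI) (metis order_refl)
    then obtain c \<tau> where c: "c > 0" "\<tau> \<in> {ts .. ts + (\<Sum>k. error_bound \<epsilon> \<nu> t k)}" "t \<longlonglongrightarrow> \<tau>" "\<epsilon> \<longlonglongrightarrow> 0"
      "\<forall>\<^sub>F k in sequentially.
        \<bar>t (Suc k) - \<tau>\<bar> \<le> (1 / (1 + c * \<sigma> k) + \<epsilon> k) / (1 - \<epsilon> k) * \<bar>t k - \<tau>\<bar>"
      using proximal_value_method_rate[OF assms hyps] by blast
    define r where "r = 1 / (1 + c * \<sigma> 0)"
    have "\<sigma> 0 > 0"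
      using hyps(2) unfolding proximal_value_method_def by blast
    then have r: "0 \<le> r" "r < 1"
      using c(1) by (simp_all add: r_def add_pos_pos)
    have "1 / (1 + c * \<sigma> k) = r" for k
      by (simp only: r_def \<sigma>[of k])
    with c(5) have rate: "\<forall>\<^sub>F k in sequentially. \<bar>t (Suc k) - \<tau>\<bar> \<le> (r + \<epsilon> k) / (1 - \<epsilon> k) * \<bar>t k - \<tau>\<bar>"
      by (simp only:)
    have "(\<lambda>k. (r + \<epsilon> k) / (1 - \<epsilon> k)) \<longlonglongrightarrow> (r + 0) / (1 - 0)"
      using c(4) by (intro tendsto_intros) auto
    \<comment> \<open>The factors tend to \<open>r < 1\<close>, so the midpoint of \<open>r\<close>
      and 1 eventually bounds them and serves as the linear rate.\<close>
    then have "\<forall>\<^sub>F k in sequentially. (r + \<epsilon> k) / (1 - \<epsilon> k) < (1 + r) / 2"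
      using r by (intro order_tendstoD(2)[where y = "(r + 0) / (1 - 0)"]) auto
    with rate have "\<forall>\<^sub>F k in sequentially. \<bar>t (Suc k) - \<tau>\<bar> \<le> (1 + r) / 2 * \<bar>t k - \<tau>\<bar>"
    proof eventually_elim
      case (elim k)
      then show ?case
        using mult_right_mono[of "(r + \<epsilon> k) / (1 - \<epsilon> k)" "(1 + r) / 2" "\<bar>t k - \<tau>\<bar>"] by linarith
    qed
    then have "converges_linearly t \<tau>"
      unfolding converges_linearly_def using c(3) r by (intro conjI exI[of _ "(1 + r) / 2"]) auto
    with c(2) show "\<exists>\<tau>\<in>{ts .. ts + (\<Sum>k. error_bound \<epsilon> \<nu> t k)}. converges_linearly t \<tau>"
      by blast
  }
qed

end
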